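(* Let $A$ be a finite nonempty subset of $\mathbb Z_{>0}$ and let $\mathcal R=\{1,3,5,\dots,m\}\cap A$, where $m\ge 1$ is an odd number. Let $\psi:\mathcal T_A\to\mathcal R\mathcal{DC}_A$ be the map sending $T$ to the cycle $(\operatorname{pw}(\hat T))$ in the symmetric group $\mathfrak S_A$. Then $\psi$ is a well-defined bijection. Consequently $|\mathcal T_A|=|\mathcal R\mathcal{DC}_A|$.
   Context: $\mathcal R$-DID trees: a tree $T$ whose vertices are positive integers is an $\mathcal R$-deformed increasing-decreasing ($\mathcal R$-DID) tree if, when $T$ is rooted at its smallest vertex, each internal vertex $v$ (vertex with at least one child) satisfies: (i) if $v$ is odd and $v\in\mathcal R$, then $v$ is less than all of its descendants, and each child of $v$ is either even or an odd vertex in $\mathcal R$; (ii) if $v$ is odd and $v\notin\mathcal R$, then $v$ is less than all of its descendants and all of its children are even; (iii) if $v$ is even, then $v$ is greater than all of its descendants and all of its children are odd and not in $\mathcal R$. $\mathcal T_A$ is the set of $\mathcal R$-DID trees with vertex set $A$. $\hat T$: for an $\mathcal R$-DID tree $T$, $\hat T$ is the plane tree obtained by rooting $T$ at its smallest vertex and ordering the children of each vertex $v$ from left to right as follows: if $v$ is even, its children in increasing order; if $v$ is odd and $v\notin\mathcal R$, its children in decreasing order; if $v\in\mathcal R$, first the children belonging to $\mathcal R$ in increasing order, then the even children in decreasing order. Postorder word: for a plane tree $T$ with root $r$ and subtrees $T_1,\dots,T_k$ (left to right) rooted at the children of $r$, $\operatorname{pw}(T)=\operatorname{pw}(T_1)\cdots\operatorname{pw}(T_k)\,r$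 (concatenation), and $\operatorname{pw}(T)=r$ if $T$ has a single vertex. For a word $w=w_1\cdots w_\ell$ containing each element of $A$ exactly once, $(w)$ denotes the cyclic permutation $w_1\mapsto w_2\mapsto\cdots\mapsto w_\ell\mapsto w_1$ of $A$. An $\mathcal R$-D-permutation on $A$ is a permutation $\sigma$ of $A$ with $i\le\sigma(i)$ whenever $i$ is odd and $i\notin\mathcal R$, and $i\ge\sigma(i)$ whenever $i$ is even. $\mathcal R\mathcal{DC}_A$ is the set of $\mathcal R$-D-cycles on $A$, i.e. $\mathcal R$-D-permutations on $A$ consisting of a single cycle of length $|A|$. *)

theory Defs
  imports "HOL-Combinatorics.Combinatorics" "HOL-Combinatorics.Orbits"
begin

text \<open>
  Finite simple undirected graphs on natural numbers; an edge is a two-element set of vertices.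
  The digraph-based \<open>tree\<close> of the AFP entry \<open>Graph_Theory\<close> is not suitable here: its \<open>forest\<close>
  counts \<open>u, v, u\<close> as a cycle of a symmetric digraph, so it does not describe undirected trees.
\<close>

record ugraph =
  verts :: "nat set"
  edges :: "nat set set"

definition adj :: "ugraph \<Rightarrow> nat \<Rightarrow> nat \<Rightarrow> bool" where
  "adj T u v \<longleftrightarrow> {u, v} \<in> edges T"

definition simple_graph :: "ugraph \<Rightarrow> bool" where
  "simple_graph T \<longleftrightarrow> finite (verts T) \<and>
     edges T \<subseteq> {{u, v} | u v. u \<in> verts T \<and> v \<in> verts T \<and> u \<noteq> v}"

definition graph_path :: "ugraph \<Rightarrow> nat \<Rightarrow> nat list \<Rightarrow> nat \<Rightarrow> bool" where
  "graph_path T u p v \<longleftrightarrow> p \<noteq> [] \<and> hd p = u \<and> last p = v \<and> distinct p \<and> set p \<subseteq> verts T \<and>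
     successively (adj T) p"

definition connected_graph :: "ugraph \<Rightarrow> bool" where
  "connected_graph T \<longleftrightarrow> verts T \<noteq> {} \<and> (\<forall>u\<in>verts T. \<forall>v\<in>verts T. \<exists>p. graph_path T u p v)"

definition acyclic_graph :: "ugraph \<Rightarrow> bool" where
  "acyclic_graph T \<longleftrightarrow> (\<nexists>p. length p \<ge> 3 \<and> distinct p \<and> successively (adj T) p \<and>
     adj T (last p) (hd p))"

definition is_tree :: "ugraph \<Rightarrow> bool" where
  "is_tree T \<longleftrightarrow> simple_graph T \<and> connected_graph T \<and> acyclic_graph T"

definition tree_root :: "ugraph \<Rightarrow> nat" where
  "tree_root T = Min (verts T)"

text \<open>
  Descendants are proper: \<open>v\<close> is not a descendant of itself. In a tree there is exactly one path
  from the root to \<open>u\<close>, so the universal quantifier says that \<open>v\<close> lies on the path to \<open>u\<close>.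
\<close>

definition descendants :: "ugraph \<Rightarrow> nat \<Rightarrow> nat set" where
  "descendants T v = {u \<in> verts T. u \<noteq> v \<and> (\<forall>p. graph_path T (tree_root T) p u \<longrightarrow> v \<in> set p)}"

definition children :: "ugraph \<Rightarrow> nat \<Rightarrow> nat set" where
  "children T v = {u \<in> descendants T v. adj T v u}"

definition RDID_tree :: "nat set \<Rightarrow> ugraph \<Rightarrow> bool" where
  "RDID_tree R T \<longleftrightarrow> is_tree T \<and> (\<forall>v\<in>verts T. v > 0) \<and>
     (\<forall>v\<in>verts T. children T v \<noteq> {} \<longrightarrow>
        (odd v \<and> v \<in> R \<longrightarrow>
           (\<forall>u\<in>descendants T v. v < u) \<and> (\<forall>c\<in>children T v. even c \<or> odd c \<and> c \<in> R)) \<and>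
        (odd v \<and> v \<notin> R \<longrightarrow>
           (\<forall>u\<in>descendants T v. v < u) \<and> (\<forall>c\<in>children T v. even c)) \<and>
        (even v \<longrightarrow>
           (\<forall>u\<in>descendants T v. v > u) \<and> (\<forall>c\<in>children T v. odd c \<and> c \<notin> R)))"

definition RDID_trees :: "nat set \<Rightarrow> nat set \<Rightarrow> ugraph set" where
  "RDID_trees R A = {T. RDID_tree R T \<and> verts T = A}"

datatype plane_tree = Node nat "plane_tree list"

definition ordered_children :: "nat set \<Rightarrow> ugraph \<Rightarrow> nat \<Rightarrow> nat list" where
  "ordered_children R T v =
     (if even v then sorted_list_of_set (children T v)
      else if v \<notin> R then rev (sorted_list_of_set (children T v))
      else sorted_list_of_set {c \<in> children T v. c \<in> R} @
           rev (sorted_list_of_set {c \<in> children T v. even c}))"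

lemma descendants_child_psubset:
  assumes T: "is_tree T" and w: "w \<in> children T v"
  shows "descendants T w \<subset> descendants T v"
proof -
  have wv: "w \<in> descendants T v" using w by (simp add: children_def)
  have fin: "finite (verts T)" and ne: "verts T \<noteq> {}"
    and con: "\<And>u v. u \<in> verts T \<Longrightarrow> v \<in> verts T \<Longrightarrow> \<exists>p. graph_path T u p v"
    using T by (auto simp: is_tree_def simple_graph_def connected_graph_def)
  have r: "tree_root T \<in> verts T" using fin ne by (simp add: tree_root_def)
  have prefix: "\<exists>q s. graph_path T (tree_root T) q x \<and> p = q @ s \<and> (x \<noteq> u \<longrightarrow> u \<notin> set q)"
    if p: "graph_path T (tree_root T) p u" and x: "x \<in> set p" for p u x
  proof -
    obtain as bs where s: "p = as @ x # bs" using x by (meson split_list)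
    have "graph_path T (tree_root T) (as @ [x]) x"
      using p unfolding graph_path_def s
      by (cases as) (auto simp: successively_append_iff successively_Cons hd_append split: if_splits)
    moreover have "u \<notin> set (as @ [x])" if "x \<noteq> u"
      using p that unfolding graph_path_def s by (cases bs rule: rev_cases) auto
    moreover have "p = (as @ [x]) @ bs" using s by simp
    ultimately show ?thesis by blast
  qed
  have anti: "v \<notin> descendants T w"
  proof
    assume v: "v \<in> descendants T w"
    then have "v \<in> verts T" "v \<noteq> w" by (auto simp: descendants_def)
    then obtain p where p: "graph_path T (tree_root T) p v" using con r by blast
    then have "w \<in> set p" using v by (auto simp: descendants_def)
    from prefix[OF p this] \<open>v \<noteq> w\<close> obtain q where "graph_path T (tree_root T) q w" "v \<notin> set q" by blast
    then show False using wv by (auto simp: descendants_def)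
  qed
  have "descendants T w \<subseteq> descendants T v"
  proof
    fix u assume u: "u \<in> descendants T w"
    then have "u \<in> verts T" "u \<noteq> v" using anti by (auto simp: descendants_def)
    moreover have "v \<in> set p" if p: "graph_path T (tree_root T) p u" for p
    proof -
      have "w \<in> set p" using u p by (auto simp: descendants_def)
      from prefix[OF p this] obtain q s where "graph_path T (tree_root T) q w" "p = q @ s" by blast
      then show ?thesis using wv by (auto simp: descendants_def)
    qed
    ultimately show "u \<in> descendants T v" by (auto simp: descendants_def)
  qed
  moreover have "w \<notin> descendants T w" by (simp add: descendants_def)
  ultimately show ?thesis using wv by blast
qed

lemma finite_descendants: "is_tree T \<Longrightarrow> finite (descendants T v)"
  by (simp add: descendants_def is_tree_def simple_graph_def)

lemma set_ordered_children_subset: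
  assumes "is_tree T" shows "set (ordered_children R T v) \<subseteq> children T v"
proof -
  have "finite (children T v)"
    using finite_descendants[OF assms, of v] by (auto simp: children_def)
  then show ?thesis by (auto simp: ordered_children_def)
qed

text \<open>The guard \<open>is_tree T\<close> only serves termination.\<close>

function plane_subtree :: "nat set \<Rightarrow> ugraph \<Rightarrow> nat \<Rightarrow> plane_tree" where
  "plane_subtree R T v =
     Node v (if is_tree T then map (plane_subtree R T) (ordered_children R T v) else [])"
  by pat_completeness auto
termination
proof (relation "measure (\<lambda>(R, T, v). card (descendants T v))")
  fix R T v w
  assume "is_tree T" "w \<in> set (ordered_children R T v)"
  then show "((R, T, w), (R, T, v)) \<in> measure (\<lambda>(R, T, v). card (descendants T v))"
    using set_ordered_children_subset descendants_child_psubset finite_descendants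
    by (fastforce intro!: psubset_card_mono)
qed simp

declare plane_subtree.simps [simp del]

definition hat :: "nat set \<Rightarrow> ugraph \<Rightarrow> plane_tree" where
  "hat R T = plane_subtree R T (tree_root T)"

fun pw :: "plane_tree \<Rightarrow> nat list" where
  "pw (Node r ts) = concat (map pw ts) @ [r]"

definition RD_permutation :: "nat set \<Rightarrow> nat set \<Rightarrow> (nat \<Rightarrow> nat) \<Rightarrow> bool" where
  "RD_permutation R A \<sigma> \<longleftrightarrow> \<sigma> permutes A \<and>
     (\<forall>i\<in>A. (odd i \<and> i \<notin> R \<longrightarrow> i \<le> \<sigma> i) \<and> (even i \<longrightarrow> i \<ge> \<sigma> i))"

definition RD_cycles :: "nat set \<Rightarrow> nat set \<Rightarrow> (nat \<Rightarrow> nat) set" where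
  "RD_cycles R A = {\<sigma>. RD_permutation R A \<sigma> \<and> cyclic_on \<sigma> A}"

text \<open>
  For a word with distinct letters, \<open>cycle_of_list w\<close> sends each letter to the next one and the
  last letter to the first, and fixes everything else.
\<close>

definition psi :: "nat set \<Rightarrow> ugraph \<Rightarrow> nat \<Rightarrow> nat" where
  "psi R T = cycle_of_list (pw (hat R T))"

end

theory Submission
  imports Defs
begin

text \<open>
  The last letter of a postorder word is the root, here \<open>Min A\<close>, so cycles on \<open>A\<close> correspond to words
  ending in \<open>Min A\<close>. Below a vertex \<open>v\<close> an even child is the maximum, and an odd child the minimum,
  of its subtree. Hence, if \<open>v\<close> is even, the last letters of the words of its subtrees are the
  right-to-left minima of the word \<open>u\<close> below \<open>v\<close>; if \<open>v \<notin> R\<close> is odd, they are the right-to-left maxima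
  of \<open>u\<close>. If \<open>v \<in> R\<close>, cut \<open>u\<close> after its last letter from \<open>R\<close> (subtrees with even root avoid \<open>R\<close>), and take
  the minima of the first part and the maxima of the second. So the word determines the tree.
  Conversely, cutting a word in this way gives a tree of the right kind: a right-to-left maximum
  is followed by a smaller letter, so an odd letter outside \<open>R\<close> cannot occur there, and dually an
  even letter is never a right-to-left minimum followed by another letter. For \<open>v \<in> R\<close> the minima of
  the first part are odd and at most a letter of \<open>R\<close>, so they lie in \<open>R\<close>, an initial segment of the
  odd elements of \<open>A\<close>.
\<close>

section \<open>Plane trees and their postorder words\<close>

fun label :: "plane_tree \<Rightarrow> nat" where
  "label (Node v ts) = v"

text \<open>Strict form of the condition on an R-D-permutation at \<open>a\<close>, with
  \<open>b\<close> as the image of \<open>a\<close>. A cycle of length at least two has no fixed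
  points, so there the strict and the weak form agree.\<close>

definition step_ok :: "nat set \<Rightarrow> nat \<Rightarrow> nat \<Rightarrow> bool" where
  "step_ok R a b \<longleftrightarrow> (odd a \<and> a \<notin> R \<longrightarrow> a < b) \<and> (even a \<longrightarrow> b < a)"

text \<open>\<open>C\<close> and \<open>D\<close> stand for the children and the descendants of
  \<open>v\<close>. Keeping them abstract lets the same condition serve graphs and plane
  trees.\<close>

definition vertex_ok :: "nat set \<Rightarrow> nat \<Rightarrow> nat set \<Rightarrow> nat set \<Rightarrow> bool" where
  "vertex_ok R v C D \<longleftrightarrow>
     (odd v \<and> v \<in> R \<longrightarrow> (\<forall>u\<in>D. v < u) \<and> (\<forall>c\<in>C. even c \<or> odd c \<and> c \<in> R)) \<and>
     (odd v \<and> v \<notin> R \<longrightarrow> (\<forall>u\<in>D. v < u) \<and> (\<forall>c\<in>C. even c)) \<and>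
     (even v \<longrightarrow> (\<forall>u\<in>D. v > u) \<and> (\<forall>c\<in>C. odd c \<and> c \<notin> R))"

definition child_order :: "nat set \<Rightarrow> nat \<Rightarrow> nat set \<Rightarrow> nat list" where
  "child_order R v C =
     (if even v then sorted_list_of_set C
      else if v \<notin> R then rev (sorted_list_of_set C)
      else sorted_list_of_set {c \<in> C. c \<in> R} @ rev (sorted_list_of_set {c \<in> C. even c}))"

text \<open>Local description of the values of \<open>hat\<close>. Distinct labels and a minimal
  root are added separately in \<open>bij_betw_hat\<close>.\<close>

fun rdid_plane :: "nat set \<Rightarrow> plane_tree \<Rightarrow> bool" where
  "rdid_plane R (Node v ts) \<longleftrightarrow>
     vertex_ok R v (label ` set ts) (\<Union>t\<in>set ts. set (pw t)) \<and>
     map label ts = child_order R v (label ` set ts) \<and> (\<forall>t\<in>set ts. rdid_plane R t)"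

lemma pw_not_Nil [simp]: "pw t \<noteq> []"
  by (cases t) simp

lemma last_pw [simp]: "last (pw t) = label t"
  by (cases t) simp

lemma label_in_pw [simp]: "label t \<in> set (pw t)"
  by (cases t) simp

section \<open>Factorization of a word at its right-to-left maxima\<close>

text \<open>
  The words in a block list end at the right-to-left maxima, with respect to the key \<open>f\<close>, of their
  concatenation; the key \<open>\<lambda>n. - int n\<close> gives the right-to-left minima.
\<close>

definition blocks :: "('a \<Rightarrow> int) \<Rightarrow> 'a list list \<Rightarrow> bool" where
  "blocks f bs \<longleftrightarrow> (\<forall>b\<in>set bs. b \<noteq> [] \<and> (\<forall>y\<in>set b. f y \<le> f (last b))) \<and>
     sorted_wrt (\<lambda>b c. f (last c) < f (last b)) bs"

lemma blocks_Nil [simp]: "blocks f []"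
  by (simp add: blocks_def)

lemma blocks_Cons:
  "blocks f (b # bs) \<longleftrightarrow> b \<noteq> [] \<and> (\<forall>y\<in>set b. f y \<le> f (last b)) \<and>
     (\<forall>c\<in>set bs. f (last c) < f (last b)) \<and> blocks f bs"
  by (auto simp: blocks_def)

text \<open>Serves to append the parent letter as a final block, so that every block of the word
  below it is followed by some letter.\<close>

lemma blocks_snoc:
  assumes "blocks f bs" "\<forall>y\<in>set (concat bs). f x < f y"
  shows "blocks f (bs @ [[x]])"
  using assms by (auto simp: blocks_def sorted_wrt_append)

lemma blocks_tail_less:
  assumes "blocks f (b # bs)" "y \<in> set (concat bs)"
  shows "f y < f (last b)"
  using assms unfolding blocks_Cons
  by (auto simp: blocks_def) (meson le_less_trans)

text \<open>Build the word from the right. The end of the first block has the largest key so far; a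
  new letter with a larger key opens its own block, any other letter joins the first block.\<close>

lemma blocks_exist: "\<exists>bs. blocks f bs \<and> concat bs = w"
proof (induction w)
  case Nil
  show ?case by (intro exI[of _ "[]"]) simp
next
  case (Cons x w)
  then obtain bs where bs: "blocks f bs" "concat bs = w" by blast
  show ?case
  proof (cases bs)
    case Nil
    with bs show ?thesis by (intro exI[of _ "[[x]]"]) (auto simp: blocks_Cons)
  next
    case (Cons b cs)
    show ?thesis
    proof (cases "f (last b) < f x")
      case True
      with bs Cons show ?thesis
        by (intro exI[of _ "[x] # bs"]) (fastforce simp: blocks_Cons)
    next
      case False
      with bs Cons show ?thesis
        by (intro exI[of _ "(x # b) # cs"]) (fastforce simp: blocks_Cons)
    qed
  qed
qed

text \<open>If the first blocks differ, one is a proper prefix of the other. The end of the longer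
  one then has a key at least that of the end of the shorter one, being maximal in its block, and
  also a smaller one, since it occurs after the shorter block.\<close>

lemma blocks_unique:
  assumes "blocks f bs" "blocks f cs" "concat bs = concat cs"
  shows "bs = cs"
  using assms
proof (induction bs arbitrary: cs)
  case Nil
  then show ?case by (cases cs) (auto simp: blocks_Cons)
next
  case (Cons b bs)
  then obtain c cs' where cs: "cs = c # cs'" by (cases cs) (auto simp: blocks_Cons)
  have longer: False
    if "blocks f (b # bs)" "blocks f ((b @ z) # cs)" "concat bs = z @ concat cs" "z \<noteq> []"
    for b z :: "'a list" and bs cs
  proof -
    have "last z \<in> set (concat bs)" using that by simp
    then have "f (last z) < f (last b)" using that(1) blocks_tail_less by metis
    moreover have "b \<noteq> []" "f (last b) \<le> f (last (b @ z))"
      using that by (auto simp: blocks_Cons)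
    ultimately show False using that(4) by simp
  qed
  have eq: "b @ concat bs = c @ concat cs'" using Cons.prems cs by simp
  then obtain z where
    "b = c @ z \<and> z @ concat bs = concat cs' \<or> b @ z = c \<and> concat bs = z @ concat cs'"
    by (auto simp: append_eq_append_conv2)
  then have "z = []"
  proof
    assume "b = c @ z \<and> z @ concat bs = concat cs'"
    then show "z = []" using longer[of c cs' z bs] Cons.prems cs by metis
  next
    assume "b @ z = c \<and> concat bs = z @ concat cs'"
    then show "z = []" using longer[of b bs z cs'] Cons.prems cs by metis
  qed
  then have "b = c" using \<open>b = c @ z \<and> _ \<or> _\<close> by auto
  then show ?case using Cons cs eq by (simp add: blocks_Cons)
qed

text \<open>The letter right after \<open>b\<close> belongs to a later block, and all later letters
  have smaller keys; the final block \<open>c\<close> ensures that there is such a letter. With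
  \<open>P\<close> as \<open>step_ok R\<close> this decides the parity of
  \<open>last b\<close>.\<close>

lemma blocks_next:
  assumes "blocks f (bs @ [c])" "successively P (concat (bs @ [c]))" "b \<in> set bs"
  obtains y where "P (last b) y" "f y < f (last b)"
proof -
  obtain as ds where split: "bs = as @ b # ds" using assms(3) by (meson split_list)
  define r where "r = concat (ds @ [c])"
  have bl: "blocks f (b # ds @ [c])"
    using assms(1) split by (auto simp: blocks_def sorted_wrt_append)
  then have ne: "b \<noteq> []" "r \<noteq> []" by (auto simp: blocks_def r_def)
  have "successively P (b @ r)"
    using assms(2) split by (auto simp: r_def successively_append_iff)
  then have "P (last b) (hd r)" using ne by (simp add: successively_append_iff)
  moreover have "f (hd r) < f (last b)"
    using blocks_tail_less[OF bl] ne hd_in_set unfolding r_def by metis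
  ultimately show thesis using that by blast
qed

text \<open>The condition across blocks is required for all pairs, not just neighbours, because in
  this form it follows from the sortedness of the roots.\<close>

lemma successively_concat:
  assumes "\<forall>b\<in>set bs. b \<noteq> [] \<and> successively P b"
    and "sorted_wrt (\<lambda>b c. P (last b) (hd c)) bs"
  shows "successively P (concat bs)"
  using assms
proof (induction bs)
  case (Cons b bs)
  then show ?case by (cases bs) (auto simp: successively_append_iff)
qed simp

lemma sorted_list_of_set_strict: "sorted_wrt (<) xs \<Longrightarrow> sorted_list_of_set (set xs) = (xs :: nat list)"
  using strict_sorted_iff sorted_list_of_set.idem_if_sorted_distinct by blast

lemma rev_sorted_list_of_set_strict:
  "sorted_wrt (>) xs \<Longrightarrow> rev (sorted_list_of_set (set xs)) = (xs :: nat list)"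
  using sorted_list_of_set_strict[of "rev xs"] by (simp add: sorted_wrt_rev)

lemma sorted_wrt_rev_sorted_list_of_set:
  "sorted_wrt (>) (rev (sorted_list_of_set (S :: nat set)))"
  by (simp add: sorted_wrt_rev)

section \<open>Postorder words of R-DID plane trees\<close>

lemma rdid_plane_extremal:
  assumes "rdid_plane R t" "y \<in> set (pw t)"
  shows "even (label t) \<Longrightarrow> y \<le> label t" "odd (label t) \<Longrightarrow> label t \<le> y"
  using assms by (cases t; fastforce simp: vertex_ok_def)+

text \<open>A vertex outside \<open>R\<close> has no child in \<open>R\<close>: below an odd one all
  children are even, below an even one they are odd and outside \<open>R\<close>.\<close>

lemma rdid_plane_disjoint:
  assumes R: "\<forall>a\<in>R. odd a"
  shows "rdid_plane R t \<Longrightarrow> label t \<notin> R \<Longrightarrow> set (pw t) \<inter> R = {}"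
proof (induction t)
  case (Node v ts)
  have "label t \<notin> R" if "t \<in> set ts" for t
    using Node.prems that R by (auto simp: vertex_ok_def)
  then have "set (pw t) \<inter> R = {}" if "t \<in> set ts" for t
    using Node that by auto
  then show ?case using Node.prems by auto
qed

lemma blocks_pw_decreasing:
  assumes "\<forall>t\<in>set ts. rdid_plane R t \<and> even (label t)" "sorted_wrt (>) (map label ts)"
  shows "blocks int (map pw ts)"
  using assms rdid_plane_extremal by (fastforce simp: blocks_def sorted_wrt_map)

lemma blocks_pw_increasing:
  assumes "\<forall>t\<in>set ts. rdid_plane R t \<and> odd (label t)" "sorted_wrt (<) (map label ts)"
  shows "blocks (\<lambda>n. - int n) (map pw ts)"
  using assms rdid_plane_extremal by (fastforce simp: blocks_def sorted_wrt_map)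

lemma rdid_plane_children_even:
  assumes "rdid_plane R (Node v ts)" "even v"
  shows "\<forall>t\<in>set ts. rdid_plane R t \<and> odd (label t) \<and> label t \<notin> R" "sorted_wrt (<) (map label ts)"
  using assms by (auto simp: vertex_ok_def child_order_def)

lemma rdid_plane_children_odd:
  assumes "rdid_plane R (Node v ts)" "odd v" "v \<notin> R"
  shows "\<forall>t\<in>set ts. rdid_plane R t \<and> even (label t)" "sorted_wrt (>) (map label ts)"
  using assms
  by (auto simp: vertex_ok_def child_order_def sorted_wrt_rev_sorted_list_of_set)

lemma rdid_plane_children_R:
  assumes R: "\<forall>a\<in>R. odd a" and "rdid_plane R (Node v ts)" "v \<in> R"
  obtains us vs where "ts = us @ vs"
    "\<forall>t\<in>set us. rdid_plane R t \<and> odd (label t) \<and> label t \<in> R" "sorted_wrt (<) (map label us)"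
    "\<forall>t\<in>set vs. rdid_plane R t \<and> even (label t)" "sorted_wrt (>) (map label vs)"
proof -
  let ?C = "label ` set ts"
  have "map label ts = sorted_list_of_set {c \<in> ?C. c \<in> R} @ rev (sorted_list_of_set {c \<in> ?C. even c})"
    using assms by (auto simp: child_order_def)
  then obtain us vs where "ts = us @ vs" and
    us: "map label us = sorted_list_of_set {c \<in> ?C. c \<in> R}" and
    vs: "map label vs = rev (sorted_list_of_set {c \<in> ?C. even c})"
    unfolding map_eq_append_conv by metis
  moreover have "label ` set us = {c \<in> ?C. c \<in> R}"
    using arg_cong[OF us, of set] by simp
  moreover have "label ` set vs = {c \<in> ?C. even c}"
    using arg_cong[OF vs, of set] by simp
  ultimately show thesis using assms sorted_wrt_rev_sorted_list_of_set
    by (intro that[of us vs]) auto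
qed

text \<open>Inside a subtree the steps are fine by induction. The word of a subtree ends in its
  root, so a step across a boundary goes from a child of \<open>v\<close> into a later sibling
  subtree or to \<open>v\<close>. The order of the siblings and the extremality of their roots
  handle the first, \<open>vertex_ok\<close> the second.\<close>

lemma successively_pw:
  assumes R: "\<forall>a\<in>R. odd a"
  shows "rdid_plane R t \<Longrightarrow> distinct (pw t) \<Longrightarrow> successively (step_ok R) (pw t)"
proof (induction t)
  case (Node v ts)
  let ?Q = "\<lambda>b c. step_ok R (last b) (hd c)"
  have hd: "hd (pw t) \<in> set (pw t)" for t by simp
  have dist: "distinct (pw t)" if "t \<in> set ts" for t
    using Node.prems(2) that by (auto simp: distinct_concat_iff)
  have "sorted_wrt ?Q (map pw ts)"
  proof -
    consider "even v" | "odd v" "v \<notin> R" | "odd v" "v \<in> R" by blast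
    then show ?thesis
    proof cases
      case 1
      note c = rdid_plane_children_even[OF Node.prems(1) 1]
      show ?thesis unfolding sorted_wrt_map last_pw
      proof (rule sorted_wrt_mono_rel)
        show "sorted_wrt (\<lambda>s t. label s < label t) ts" using c(2) by (simp add: sorted_wrt_map)
      next
        fix s t assume "s \<in> set ts" "t \<in> set ts" "label s < label t"
        then show "step_ok R (label s) (hd (pw t))"
          using c(1) rdid_plane_extremal(2)[OF _ hd] by (fastforce simp: step_ok_def)
      qed
    next
      case 2
      note c = rdid_plane_children_odd[OF Node.prems(1) 2]
      show ?thesis unfolding sorted_wrt_map last_pw
      proof (rule sorted_wrt_mono_rel)
        show "sorted_wrt (\<lambda>s t. label s > label t) ts" using c(2) by (simp add: sorted_wrt_map)
      next
        fix s t assume "s \<in> set ts" "t \<in> set ts" "label s > label t"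
        then show "step_ok R (label s) (hd (pw t))"
          using c(1) rdid_plane_extremal(1)[OF _ hd] by (fastforce simp: step_ok_def)
      qed
    next
      case 3
      obtain us vs where c: "ts = us @ vs"
        "\<forall>t\<in>set us. rdid_plane R t \<and> odd (label t) \<and> label t \<in> R"
        "\<forall>t\<in>set vs. rdid_plane R t \<and> even (label t)" "sorted_wrt (>) (map label vs)"
        using rdid_plane_children_R[OF R Node.prems(1) 3(2)] by metis
      have "sorted_wrt (\<lambda>s t. step_ok R (label s) (hd (pw t))) vs"
      proof (rule sorted_wrt_mono_rel)
        show "sorted_wrt (\<lambda>s t. label s > label t) vs" using c by (simp add: sorted_wrt_map)
      next
        fix s t assume "s \<in> set vs" "t \<in> set vs" "label s > label t"
        then show "step_ok R (label s) (hd (pw t))"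
          using c(3) rdid_plane_extremal(1)[OF _ hd] by (fastforce simp: step_ok_def)
      qed
      \<comment> \<open>An odd letter of \<open>R\<close> may be followed by anything, so the
        trivial relation suffices here.\<close>
      moreover have "sorted_wrt (\<lambda>s t. step_ok R (label s) (hd (pw t))) us"
        by (rule sorted_wrt_mono_rel[of _ "\<lambda>_ _. True"]) (use c in \<open>auto simp: step_ok_def\<close>)
      ultimately show ?thesis
        using c by (auto simp: sorted_wrt_map sorted_wrt_append step_ok_def)
    qed
  qed
  moreover have "step_ok R (label t) v" if "t \<in> set ts" for t
    using Node.prems(1) that label_in_pw[of t] by (auto simp: vertex_ok_def step_ok_def)
  ultimately have "sorted_wrt ?Q (map pw ts @ [[v]])"
    by (auto simp: sorted_wrt_append)
  moreover have "\<forall>b\<in>set (map pw ts @ [[v]]). b \<noteq> [] \<and> successively (step_ok R) b"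
    using Node dist by auto
  ultimately have "successively (step_ok R) (concat (map pw ts @ [[v]]))"
    using successively_concat by blast
  then show ?case by simp
qed

text \<open>Makes the cut after the last letter of \<open>R\<close> canonical when two words below a
  vertex of \<open>R\<close> are compared.\<close>

lemma append_eq_by_last:
  assumes "u @ v = u' @ v'" "u \<noteq> [] \<longrightarrow> P (last u)" "u' \<noteq> [] \<longrightarrow> P (last u')"
    "\<forall>x\<in>set v. \<not> P x" "\<forall>x\<in>set v'. \<not> P x"
  shows "u = u' \<and> v = v'"
proof -
  have aux: "z = []" if "u @ z = u'" "v = z @ v'" "u' \<noteq> [] \<longrightarrow> P (last u')" "\<forall>x\<in>set v. \<not> P x"
    for u u' v v' z :: "'a list"
    using that by (metis Un_iff append_is_Nil_conv last_appendR last_in_set set_append)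
  from assms(1) obtain z where
    "u = u' @ z \<and> z @ v = v' \<or> u @ z = u' \<and> v = z @ v'"
    by (auto simp: append_eq_append_conv2)
  then have "z = []" using aux[of u z u' v v'] aux[of u' z u v' v] assms by auto
  then show ?thesis using \<open>u = u' @ z \<and> _ \<or> _\<close> by auto
qed

lemma pw_injective:
  assumes R: "\<forall>a\<in>R. odd a"
  shows "rdid_plane R t \<Longrightarrow> rdid_plane R t' \<Longrightarrow> pw t = pw t' \<Longrightarrow> t = t'"
proof (induction t arbitrary: t')
  case (Node v ts)
  obtain ts' where t': "t' = Node v ts'" using Node.prems(3) by (cases t') auto
  have g: "rdid_plane R (Node v ts)" "rdid_plane R (Node v ts')" using Node.prems t' by auto
  have conc: "concat (map pw ts) = concat (map pw ts')" using Node.prems(3) t' by simp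
  consider "even v" | "odd v" "v \<notin> R" | "odd v" "v \<in> R" by blast
  then have "map pw ts = map pw ts'"
  proof cases
    case 1
    show ?thesis
      using blocks_unique[OF blocks_pw_increasing blocks_pw_increasing conc]
        rdid_plane_children_even[OF g(1) 1] rdid_plane_children_even[OF g(2) 1] by metis
  next
    case 2
    show ?thesis
      using blocks_unique[OF blocks_pw_decreasing blocks_pw_decreasing conc]
        rdid_plane_children_odd[OF g(1) 2] rdid_plane_children_odd[OF g(2) 2] by metis
  next
    case 3
    obtain us vs where c: "ts = us @ vs"
      "\<forall>t\<in>set us. rdid_plane R t \<and> odd (label t) \<and> label t \<in> R" "sorted_wrt (<) (map label us)"
      "\<forall>t\<in>set vs. rdid_plane R t \<and> even (label t)" "sorted_wrt (>) (map label vs)"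
      using rdid_plane_children_R[OF R g(1) 3(2)] by metis
    obtain us' vs' where c': "ts' = us' @ vs'"
      "\<forall>t\<in>set us'. rdid_plane R t \<and> odd (label t) \<and> label t \<in> R" "sorted_wrt (<) (map label us')"
      "\<forall>t\<in>set vs'. rdid_plane R t \<and> even (label t)" "sorted_wrt (>) (map label vs')"
      using rdid_plane_children_R[OF R g(2) 3(2)] by metis
    \<comment> \<open>The boundary between subtrees with root in \<open>R\<close> and subtrees with
      even root falls right after the last letter of \<open>R\<close>: the former end in a letter of
      \<open>R\<close>, the latter avoid \<open>R\<close>.\<close>
    have lastR: "last (concat (map pw us)) \<in> R"
      if "concat (map pw us) \<noteq> []" "\<forall>t\<in>set us. label t \<in> R" for us
      using that by (cases us rule: rev_cases) auto
    have noR: "\<forall>x\<in>set (concat (map pw vs)). x \<notin> R"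
      if "\<forall>t\<in>set vs. rdid_plane R t \<and> even (label t)" for vs
      using that rdid_plane_disjoint[OF R] R by fastforce
    have "concat (map pw us) = concat (map pw us') \<and> concat (map pw vs) = concat (map pw vs')"
      by (rule append_eq_by_last[where P="\<lambda>x. x \<in> R"])
        (use conc c c' lastR noR in \<open>simp_all\<close>)
    then have "map pw us = map pw us'" "map pw vs = map pw vs'"
      using blocks_unique[OF blocks_pw_increasing blocks_pw_increasing]
        blocks_unique[OF blocks_pw_decreasing blocks_pw_decreasing] c c' by metis+
    then show ?thesis using c c' by simp
  qed
  then have len: "length ts = length ts'" and nth: "\<And>i. i < length ts \<Longrightarrow> pw (ts ! i) = pw (ts' ! i)"
    using map_eq_imp_length_eq by (blast, metis length_map nth_map)
  have "ts ! i = ts' ! i" if "i < length ts" for i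
    using Node.IH[of "ts ! i" "ts' ! i"] that len nth[OF that] g by simp
  then show ?case using t' len by (simp add: nth_equalityI)
qed

section \<open>Rebuilding the tree from its word\<close>

lemma choose_trees:
  assumes "\<forall>b\<in>set bs. \<exists>t. rdid_plane R t \<and> pw t = b"
  obtains ts where "map pw ts = bs" "\<forall>t\<in>set ts. rdid_plane R t" "map label ts = map last bs"
proof -
  have "\<exists>ts. map pw ts = bs \<and> (\<forall>t\<in>set ts. rdid_plane R t)"
    using assms
  proof (induction bs)
    case (Cons b bs)
    then obtain t ts where "map pw ts = bs" "\<forall>t\<in>set ts. rdid_plane R t" "pw t = b" "rdid_plane R t"
      by auto
    then show ?case by (intro exI[of _ "t # ts"]) simp
  qed simp
  then obtain ts where "map pw ts = bs" "\<forall>t\<in>set ts. rdid_plane R t" by blast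
  moreover from this have "map label ts = map last bs" by auto
  ultimately show thesis using that by blast
qed

text \<open>The conditions are chosen to pass from a word to the blocks below its last letter. The
  one with \<open>b \<le> a\<close> says that \<open>R\<close> is an initial segment of the odd
  letters; the last one mirrors \<open>rdid_plane_disjoint\<close>.\<close>

definition plane_word :: "nat set \<Rightarrow> nat list \<Rightarrow> bool" where
  "plane_word R w \<longleftrightarrow> w \<noteq> [] \<and> distinct w \<and> successively (step_ok R) w \<and>
     (\<forall>a\<in>R. \<forall>b\<in>set w. odd b \<and> b \<le> a \<longrightarrow> b \<in> R) \<and>
     (even (last w) \<longrightarrow> (\<forall>y\<in>set w. y \<le> last w)) \<and>
     (odd (last w) \<longrightarrow> (\<forall>y\<in>set w. last w \<le> y)) \<and>
     (last w \<notin> R \<longrightarrow> set w \<inter> R = {})"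

lemma plane_tree_exists:
  assumes R: "\<forall>a\<in>R. odd a"
  shows "plane_word R w \<Longrightarrow> \<exists>t. rdid_plane R t \<and> pw t = w"
proof (induction w rule: length_induct)
  case (1 w)
  have prems: "w \<noteq> []" "distinct w" "successively (step_ok R) w"
    "\<forall>a\<in>R. \<forall>b\<in>set w. odd b \<and> b \<le> a \<longrightarrow> b \<in> R"
    "even (last w) \<Longrightarrow> \<forall>y\<in>set w. y \<le> last w"
    "odd (last w) \<Longrightarrow> \<forall>y\<in>set w. last w \<le> y"
    "last w \<notin> R \<Longrightarrow> set w \<inter> R = {}"
    using 1(2) unfolding plane_word_def by simp_all
  obtain u x where w: "w = u @ [x]" using prems(1) by (metis append_butlast_last_id)
  \<comment> \<open>A factor of \<open>u\<close> inherits distinctness, the step condition and the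
    initial-segment condition; only the conditions on its last letter are left to the
    caller.\<close>
  have sub: "\<exists>t. rdid_plane R t \<and> pw t = b"
    if "b \<noteq> []" "u = p @ b @ q" "even (last b) \<Longrightarrow> \<forall>y\<in>set b. y \<le> last b"
      "odd (last b) \<Longrightarrow> \<forall>y\<in>set b. last b \<le> y" "last b \<notin> R \<Longrightarrow> set b \<inter> R = {}" for b p q
  proof -
    have b: "length b < length w" "distinct b" "successively (step_ok R) b"
      "\<forall>a\<in>R. \<forall>c\<in>set b. odd c \<and> c \<le> a \<longrightarrow> c \<in> R"
      using prems w that(2) by (auto simp: successively_append_iff)
    then have "plane_word R b" using that by (simp add: plane_word_def)
    then show ?thesis using 1(1) b(1) by blast
  qed
  have in_concat: "\<exists>p q. concat bs = p @ b @ q" if "b \<in> set bs" for b :: "nat list" and bs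
    using that by (metis concat.simps(2) concat_append split_list)
  have split: "\<exists>p q. u = p @ b @ q" if "b \<in> set bs" "u = s @ concat bs @ t" for b bs s t
    using in_concat[OF that(1)] that(2) by (metis append.assoc)
  have xu: "x \<notin> set u" using prems(2) w by simp
  have min: "x < y" if "odd x" "y \<in> set u" for y
    using prems(6) w xu that by (metis Un_iff last_snoc le_neq_implies_less set_append)
  have noR: "a \<notin> R" if "x \<notin> R" "a \<in> set u" for a
    using prems(7) w that by auto
  \<comment> \<open>Common to both odd cases. The smaller letter \<open>x\<close> is appended as a
    final block, so each block end is followed by a smaller letter; an odd letter outside
    \<open>R\<close> could only be followed by a larger one.\<close>
  have decreasing: "even (last b)"
    if "x \<notin> R \<or> set (concat bs) \<inter> R = {}" "odd x" "blocks int bs" "u = s @ concat bs" and b: "b \<in> set bs"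
    for b bs s
  proof -
    have "blocks int (bs @ [[x]])"
      using that min by (intro blocks_snoc) auto
    moreover have "successively (step_ok R) (concat (bs @ [[x]]))"
      using prems(3) w that by (simp add: successively_append_iff)
    ultimately obtain y where "step_ok R (last b) y" "int y < int (last b)"
      using blocks_next[of int bs "[x]" "step_ok R" b] b by metis
    moreover have "b \<noteq> []" using that by (auto simp: blocks_def)
    then have "last b \<in> set (concat bs)" using b by (auto intro!: bexI[of _ b])
    then have "last b \<notin> R" using that noR by auto
    ultimately show ?thesis by (auto simp: step_ok_def)
  qed
  consider "even x" | "odd x" "x \<notin> R" | "odd x" "x \<in> R" by blast
  then show ?case
  proof cases
    case 1
    have max: "y < x" if "y \<in> set u" for y
      using prems(5) 1 w xu that by (metis Un_iff last_snoc le_neq_implies_less set_append)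
    obtain bs where bs: "blocks (\<lambda>n. - int n) bs" "concat bs = u" using blocks_exist by blast
    \<comment> \<open>Under the negated key the maximum \<open>x\<close> has the smallest key and
      can form the final block.\<close>
    have bx: "blocks (\<lambda>n. - int n) (bs @ [[x]])"
      using bs max by (intro blocks_snoc) auto
    have sx: "successively (step_ok R) (concat (bs @ [[x]]))"
      using prems(3) w bs by simp
    have odd: "odd (last b)" if b: "b \<in> set bs" for b
    proof -
      obtain y where "step_ok R (last b) y" "- int y < - int (last b)"
        using blocks_next[OF bx sx b] by blast
      then show ?thesis by (auto simp: step_ok_def)
    qed
    have "\<exists>t. rdid_plane R t \<and> pw t = b" if b: "b \<in> set bs" for b
    proof -
      obtain p q where "u = p @ b @ q" using split[of b bs "[]" "[]"] b bs by auto
      then show ?thesis using b bs odd[OF b] noR 1 R by (intro sub) (auto simp: blocks_def)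
    qed
    then obtain ts where ts: "map pw ts = bs" "\<forall>t\<in>set ts. rdid_plane R t" "map label ts = map last bs"
      using choose_trees by blast
    have lab: "odd (label t) \<and> label t \<in> set u" if "t \<in> set ts" for t
      using that ts(1) bs(2) odd[of "pw t"] by (auto intro!: bexI[of _ t])
    have "sorted_wrt (<) (map label ts)"
      using bs unfolding ts by (auto simp: blocks_def sorted_wrt_map)
    then have "map label ts = child_order R x (label ` set ts)"
      using 1 sorted_list_of_set_strict[of "map label ts"] by (simp add: child_order_def)
    moreover have "vertex_ok R x (label ` set ts) (\<Union>t\<in>set ts. set (pw t))"
    proof -
      have "(\<Union>t\<in>set ts. set (pw t)) = set u" using ts(1) bs(2) by auto
      moreover have "x \<notin> R" using 1 R by blast
      then have "label t \<notin> R" if "t \<in> set ts" for t using lab[OF that] noR by blast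
      ultimately show ?thesis using 1 max lab by (simp add: vertex_ok_def)
    qed
    ultimately show ?thesis
      using ts bs w by (intro exI[of _ "Node x ts"]) simp
  next
    case 2
    obtain bs where bs: "blocks int bs" "concat bs = u" using blocks_exist by blast
    have even: "even (last b)" if "b \<in> set bs" for b
      by (rule decreasing[of bs "[]"]) (use 2 bs that in simp_all)
    have "\<exists>t. rdid_plane R t \<and> pw t = b" if b: "b \<in> set bs" for b
    proof -
      obtain p q where "u = p @ b @ q" using split[of b bs "[]" "[]"] b bs by auto
      then show ?thesis using b bs even[OF b] noR 2 by (intro sub) (auto simp: blocks_def)
    qed
    then obtain ts where ts: "map pw ts = bs" "\<forall>t\<in>set ts. rdid_plane R t" "map label ts = map last bs"
      using choose_trees by blast
    have lab: "even (label t)" if "t \<in> set ts" for t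
      using that ts even by (auto simp flip: last_pw)
    have "sorted_wrt (>) (map label ts)"
      using bs unfolding ts by (auto simp: blocks_def sorted_wrt_map)
    then have "map label ts = child_order R x (label ` set ts)"
      using 2 rev_sorted_list_of_set_strict[of "map label ts"] by (simp add: child_order_def)
    moreover have "vertex_ok R x (label ` set ts) (\<Union>t\<in>set ts. set (pw t))"
    proof -
      have "(\<Union>t\<in>set ts. set (pw t)) = set u" using ts(1) bs(2) by auto
      then show ?thesis using 2 min lab by (simp add: vertex_ok_def)
    qed
    ultimately show ?thesis
      using ts bs w by (intro exI[of _ "Node x ts"]) simp
  next
    case 3
    \<comment> \<open>\<open>s\<close> is the part of \<open>u\<close> up to its last letter from
      \<open>R\<close>, and is empty if there is none.\<close>
    obtain s v where u: "u = s @ v" "s \<noteq> [] \<longrightarrow> last s \<in> R" "\<forall>y\<in>set v. y \<notin> R"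
    proof (cases "\<exists>y\<in>set u. y \<in> R")
      case True
      then obtain as y zs where "u = as @ y # zs" "y \<in> R" "\<forall>z\<in>set zs. z \<notin> R"
        using split_list_last_prop[of u "\<lambda>y. y \<in> R"] by blast
      then show thesis by (intro that[of "as @ [y]" zs]) auto
    next
      case False
      then show thesis by (intro that[of "[]" u]) auto
    qed
    obtain bs where bs: "blocks (\<lambda>n. - int n) bs" "concat bs = s" using blocks_exist by blast
    obtain cs where cs: "blocks int cs" "concat cs = v" using blocks_exist by blast
    \<comment> \<open>The final block of \<open>s\<close> ends in a letter of \<open>R\<close>.
      Every earlier block end is followed by a smaller letter unless it is odd in the case excluded
      by \<open>step_ok\<close>; precisely, a larger follower forces it to be odd, and being below
      the final end it lies in the initial segment \<open>R\<close>.\<close>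
    have inR: "last b \<in> R" if b: "b \<in> set bs" for b
    proof -
      obtain bs' c where c: "bs = bs' @ [c]" using b by (cases bs rule: rev_cases) auto
      have "c \<noteq> []" using bs c by (auto simp: blocks_def)
      then have cR: "last c \<in> R" using u(2) bs c by auto
      show ?thesis
      proof (cases "b \<in> set bs'")
        case True
        have "successively (step_ok R) (concat bs)"
          using prems(3) w u bs by (simp add: successively_append_iff)
        then obtain y where "step_ok R (last b) y" "- int y < - int (last b)"
          using blocks_next[OF _ _ True, of "\<lambda>n. - int n" c "step_ok R"] bs(1) c by blast
        then have "odd (last b)" by (auto simp: step_ok_def)
        moreover have "last b \<le> last c"
          using bs(1) c True by (fastforce simp: blocks_def sorted_wrt_append)
        moreover have "last b \<in> set w"
          using bs b u w by (auto simp: blocks_def intro!: bexI[of _ b])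
        ultimately show ?thesis using prems(4) cR by blast
      qed (use b c cR in auto)
    qed
    have even: "even (last b)" if "b \<in> set cs" for b
      by (rule decreasing[of cs s]) (use 3 cs u that in auto)
    have "\<exists>t. rdid_plane R t \<and> pw t = b" if b: "b \<in> set bs" for b
    proof -
      obtain p q where "u = p @ b @ q" using split[of b bs "[]" v] b bs u by auto
      then show ?thesis using b bs inR[OF b] R by (intro sub) (auto simp: blocks_def)
    qed
    then obtain ts where ts: "map pw ts = bs" "\<forall>t\<in>set ts. rdid_plane R t" "map label ts = map last bs"
      using choose_trees by blast
    have "\<exists>t. rdid_plane R t \<and> pw t = b" if b: "b \<in> set cs" for b
    proof -
      obtain p q where "u = p @ b @ q" using split[of b cs s "[]"] b cs u by auto
      then show ?thesis using b cs u even[OF b] by (intro sub) (auto simp: blocks_def)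
    qed
    then obtain ts' where ts': "map pw ts' = cs" "\<forall>t\<in>set ts'. rdid_plane R t"
      "map label ts' = map last cs"
      using choose_trees by blast
    have lab: "label t \<in> R" if "t \<in> set ts" for t
      using that ts inR by (auto simp flip: last_pw)
    have lab': "even (label t)" if "t \<in> set ts'" for t
      using that ts' even by (auto simp flip: last_pw)
    have sorted: "sorted_wrt (<) (map label ts)" "sorted_wrt (>) (map label ts')"
      using bs cs unfolding ts ts' by (auto simp: blocks_def sorted_wrt_map)
    have "{c \<in> label ` set (ts @ ts'). c \<in> R} = set (map label ts)"
      "{c \<in> label ` set (ts @ ts'). even c} = set (map label ts')"
      using lab lab' R by auto
    then have "map label (ts @ ts') = child_order R x (label ` set (ts @ ts'))"
      using 3 sorted_list_of_set_strict[OF sorted(1)] rev_sorted_list_of_set_strict[OF sorted(2)]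
      by (simp add: child_order_def)
    moreover have "vertex_ok R x (label ` set (ts @ ts')) (\<Union>t\<in>set (ts @ ts'). set (pw t))"
    proof -
      have "(\<Union>t\<in>set (ts @ ts'). set (pw t)) = set u"
        using ts(1) bs(2) ts'(1) cs(2) u(1) by auto
      then show ?thesis using 3 R min lab lab' by (auto simp: vertex_ok_def)
    qed
    ultimately show ?thesis
      using ts ts' bs cs w u by (intro exI[of _ "Node x (ts @ ts')"]) auto
  qed
qed

section \<open>Rooted trees as graphs\<close>

fun parent_rel :: "plane_tree \<Rightarrow> (nat \<times> nat) set" where
  "parent_rel (Node v ts) = (\<Union>t\<in>set ts. insert (v, label t) (parent_rel t))"

definition tree_graph :: "plane_tree \<Rightarrow> ugraph" where
  "tree_graph t = \<lparr>verts = set (pw t), edges = (\<lambda>(a, b). {a, b}) ` parent_rel t\<rparr>"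

section \<open>Root paths, children and descendants\<close>

lemma adj_sym: "adj T u v \<longleftrightarrow> adj T v u"
  by (simp add: adj_def insert_commute)

lemma graph_path_prefix: "graph_path T r (p @ x # q) v \<Longrightarrow> graph_path T r (p @ [x]) x"
  by (cases p) (auto simp: graph_path_def successively_append_iff successively_Cons hd_append
      split: if_splits)

text \<open>Suppose two paths leave \<open>u\<close> along different edges. The first path up to its
  first vertex \<open>x\<close> on the second, followed by the second path backwards from
  \<open>x\<close>, closes up at \<open>u\<close> to a cycle.\<close>

lemma graph_path_unique:
  assumes "acyclic_graph T"
  shows "graph_path T u p v \<Longrightarrow> graph_path T u q v \<Longrightarrow> p = q"
proof (induction p arbitrary: u q)
  case Nil
  then show ?case by (simp add: graph_path_def)
next
  case (Cons u' p)
  then have u': "u' = u" by (simp add: graph_path_def)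
  obtain q' where q: "q = u # q'" using Cons.prems(2) by (cases q) (auto simp: graph_path_def)
  show ?case
  proof (cases "p = [] \<or> q' = []")
    case True
    then show ?thesis
      using Cons.prems u' q by (auto simp: graph_path_def split: if_splits dest: last_in_set)
  next
    case False
    then obtain a p1 b q1 where ab: "p = a # p1" "q' = b # q1" by (meson list.exhaust)
    have p: "graph_path T a p v" and q': "graph_path T b q' v"
      and uv: "u \<notin> set p" "u \<notin> set q'" "adj T u a" "adj T u b"
      using Cons.prems u' q ab by (auto simp: graph_path_def)
    have "a = b"
    proof (rule ccontr)
      assume "a \<noteq> b"
      have "v \<in> set p" "v \<in> set q'" using p q' last_in_set unfolding graph_path_def by metis+
      then obtain c x d where c: "p = c @ x # d" "x \<in> set q'" "\<forall>y\<in>set c. y \<notin> set q'"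
        using split_list_first_prop[of p "\<lambda>x. x \<in> set q'"] by blast
      obtain e g where e: "q' = e @ x # g" using c(2) by (meson split_list)
      let ?c = "u # c @ x # rev e"
      have "distinct ?c"
        using p q' uv c e by (auto simp: graph_path_def)
      \<comment> \<open>If both were empty, then \<open>a = x = b\<close>; so the cycle has at least
        three vertices.\<close>
      moreover have "c \<noteq> [] \<or> e \<noteq> []" using \<open>a \<noteq> b\<close> ab c e by auto
      then have "length ?c \<ge> 3" by (cases c; cases e) auto
      moreover have "successively (adj T) ?c"
      proof -
        have "successively (adj T) (c @ [x])"
          using p c by (auto simp: graph_path_def successively_append_iff)
        moreover have "successively (adj T) (rev (e @ [x]))"
          unfolding successively_rev
          using q' e adj_sym[of T] by (auto simp: graph_path_def successively_append_iff)
        moreover have "hd (c @ [x]) = a" using c ab by (cases c) auto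
        ultimately show ?thesis using uv
          by (cases c) (auto simp: successively_append_iff successively_Cons hd_append)
      qed
      moreover have "last ?c = b" using e ab by (cases e) auto
      ultimately show False
        using assms uv adj_sym unfolding acyclic_graph_def by (metis list.sel(1))
    qed
    then show ?thesis using Cons.IH[OF p] q' u' q by simp
  qed
qed

definition root_path :: "ugraph \<Rightarrow> nat \<Rightarrow> nat list" where
  "root_path T v = (THE p. graph_path T (tree_root T) p v)"

context
  fixes T assumes tree: "is_tree T"
begin

lemma root_path_eqI: "graph_path T (tree_root T) p v \<Longrightarrow> root_path T v = p"
  unfolding root_path_def using tree graph_path_unique by (auto simp: is_tree_def)

lemma tree_root_in_verts: "tree_root T \<in> verts T"
  using tree by (simp add: is_tree_def simple_graph_def connected_graph_def tree_root_def)

lemma root_path: "v \<in> verts T \<Longrightarrow> graph_path T (tree_root T) (root_path T v) v"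
  using tree tree_root_in_verts root_path_eqI unfolding is_tree_def connected_graph_def by metis

lemma root_path_props:
  assumes "v \<in> verts T"
  shows "hd (root_path T v) = tree_root T" "last (root_path T v) = v" "distinct (root_path T v)"
    "root_path T v \<noteq> []" "set (root_path T v) \<subseteq> verts T" "v \<in> set (root_path T v)"
  using root_path[OF assms] last_in_set unfolding graph_path_def by metis+

lemma root_path_prefix: "v \<in> verts T \<Longrightarrow> root_path T v = p @ x # q \<Longrightarrow> root_path T x = p @ [x]"
  using root_path graph_path_prefix root_path_eqI by metis

lemma root_path_root: "root_path T (tree_root T) = [tree_root T]"
  by (rule root_path_eqI) (simp add: graph_path_def tree_root_in_verts)

lemma adj_in_verts: "adj T u v \<Longrightarrow> u \<in> verts T \<and> v \<in> verts T \<and> u \<noteq> v"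
  using tree by (auto simp: is_tree_def simple_graph_def adj_def doubleton_eq_iff dest!: subsetD)

lemma root_path_snoc:
  assumes "adj T u v" "v \<notin> set (root_path T u)"
  shows "root_path T v = root_path T u @ [v]"
  using assms root_path[of u] adj_in_verts
  by (intro root_path_eqI) (auto simp: graph_path_def successively_append_iff)

lemma descendants_iff:
  "u \<in> descendants T v \<longleftrightarrow> u \<in> verts T \<and> u \<noteq> v \<and> v \<in> set (root_path T u)"
  unfolding descendants_def using root_path root_path_eqI by blast

text \<open>The path to an ancestor \<open>v\<close> of \<open>u\<close> is a proper prefix of the
  path to \<open>u\<close>, which visits \<open>u\<close> only at its end.\<close>

lemma not_in_root_path:
  assumes "u \<in> verts T" "v \<in> set (root_path T u)" "u \<noteq> v"
  shows "u \<notin> set (root_path T v)"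
proof
  obtain as bs where s: "root_path T u = as @ v # bs" using assms(2) by (meson split_list)
  have "bs \<noteq> []" "last bs = u" using root_path_props(2)[OF assms(1)] s assms(3) by auto
  then have "u \<in> set bs" by auto
  moreover assume "u \<in> set (root_path T v)"
  ultimately show False
    using root_path_prefix[OF assms(1) s] root_path_props(3)[OF assms(1)] s by auto
qed

text \<open>Turns questions about children into questions about lists. A child is not on the path to
  its parent, so the edge between them extends that path.\<close>

lemma children_iff:
  "c \<in> children T v \<longleftrightarrow> c \<in> verts T \<and> v \<in> verts T \<and> root_path T c = root_path T v @ [c]"
proof
  assume c: "c \<in> children T v"
  then have "c \<in> verts T" "c \<noteq> v" "v \<in> set (root_path T c)" "adj T v c"
    by (auto simp: children_def descendants_iff)
  then show "c \<in> verts T \<and> v \<in> verts T \<and> root_path T c = root_path T v @ [c]"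
    using not_in_root_path root_path_snoc adj_in_verts by blast
next
  assume c: "c \<in> verts T \<and> v \<in> verts T \<and> root_path T c = root_path T v @ [c]"
  then have "adj T v c"
    using root_path[of c] root_path_props[of v] by (auto simp: graph_path_def successively_append_iff)
  then show "c \<in> children T v"
    using c adj_in_verts root_path_props(6)[of v] by (auto simp: children_def descendants_iff)
qed

text \<open>The child of \<open>v\<close> above or equal to \<open>u\<close> is the vertex right
  after \<open>v\<close> on the path to \<open>u\<close>.\<close>

lemma descendants_decomp: "descendants T v = (\<Union>c\<in>children T v. insert c (descendants T c))"
proof (intro equalityI subsetI)
  fix u assume u: "u \<in> descendants T v"
  then obtain as bs where s: "root_path T u = as @ v # bs" and uv: "u \<in> verts T" "u \<noteq> v"
    by (auto simp: descendants_iff dest: split_list)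
  then obtain c ds where bs: "bs = c # ds"
    using root_path_props(2)[OF uv(1)] by (cases bs) auto
  have "root_path T v = as @ [v]" "root_path T c = (as @ [v]) @ [c]"
    using root_path_prefix[OF uv(1), of as v bs] root_path_prefix[OF uv(1), of "as @ [v]" c ds] s bs
    by auto
  moreover have "c \<in> verts T" "v \<in> verts T" using root_path_props(5)[OF uv(1)] s bs by auto
  ultimately have "c \<in> children T v" by (simp add: children_iff)
  moreover have "c \<in> set (root_path T u)" using s bs by simp
  ultimately show "u \<in> (\<Union>c\<in>children T v. insert c (descendants T c))"
    using uv by (auto simp: descendants_iff)
next
  fix u assume "u \<in> (\<Union>c\<in>children T v. insert c (descendants T c))"
  then show "u \<in> descendants T v"
    using descendants_child_psubset[OF tree] by (auto simp: children_def)
qed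

text \<open>Two distinct vertices cannot each lie on the root path of the other, so the edge extends
  one of the two paths.\<close>

lemma adj_children: "adj T u v \<Longrightarrow> v \<in> children T u \<or> u \<in> children T v"
  using adj_in_verts not_in_root_path root_path_snoc adj_sym unfolding children_iff by metis

lemma children_asym: "v \<in> children T u \<Longrightarrow> u \<notin> children T v"
  by (auto simp: children_iff dest: arg_cong[of _ _ length])

text \<open>Both \<open>c\<close> and \<open>c'\<close> come directly after
  \<open>root_path T v\<close> on the path to \<open>u\<close>.\<close>

lemma children_descendants_disjoint:
  assumes "c \<in> children T v" "c' \<in> children T v"
    "u \<in> insert c (descendants T c)" "u \<in> insert c' (descendants T c')"
  shows "c = c'"
proof -
  have u: "u \<in> verts T" "c \<in> set (root_path T u)" "c' \<in> set (root_path T u)"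
    using assms root_path_props(6)[of u] by (auto simp: descendants_iff children_iff)
  obtain as bs as' bs' where s: "root_path T u = as @ c # bs" "root_path T u = as' @ c' # bs'"
    using u by (meson split_list)
  then have "as = root_path T v" "as' = root_path T v"
    using assms(1,2) root_path_prefix[OF u(1) s(1)] root_path_prefix[OF u(1) s(2)]
    by (simp_all add: children_iff)
  then show ?thesis using s by simp
qed

lemma verts_eq: "verts T = insert (tree_root T) (descendants T (tree_root T))"
  using root_path_props tree_root_in_verts by (auto simp: descendants_iff) (metis hd_in_set)

lemma finite_children: "finite (children T v)"
  using finite_descendants[OF tree] by (simp add: children_def)

lemma ordered_children_eq: "ordered_children R T v = child_order R v (children T v)"
  by (simp add: ordered_children_def child_order_def)

text \<open>For \<open>v\<close> in \<open>R\<close> the order lists the children in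
  \<open>R\<close> and the even ones; by \<open>vertex_ok\<close> these are all children, and no
  child is listed twice because \<open>R\<close> is odd.\<close>

lemma set_ordered_children:
  assumes "\<forall>a\<in>R. odd a" "vertex_ok R v (children T v) D"
  shows "set (ordered_children R T v) = children T v" "distinct (ordered_children R T v)"
proof -
  have "set (ordered_children R T v) = children T v \<and> distinct (ordered_children R T v)"
  proof (cases "odd v \<and> v \<in> R")
    case True
    then have "{c \<in> children T v. c \<in> R} \<union> {c \<in> children T v. even c} = children T v"
      using assms by (auto simp: vertex_ok_def)
    moreover have "{c \<in> children T v. c \<in> R} \<inter> {c \<in> children T v. even c} = {}"
      using assms by auto
    ultimately show ?thesis
      using True finite_children[of v] by (simp add: ordered_children_def)
  next
    case False
    then show ?thesis using finite_children[of v] by (auto simp: ordered_children_def)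
  qed
  then show "set (ordered_children R T v) = children T v" "distinct (ordered_children R T v)" by auto
qed

end

section \<open>From an R-DID tree to its plane tree\<close>

text \<open>A vertex without children has no descendants, so \<open>vertex_ok\<close> is vacuous at
  leaves.\<close>

lemma RDID_tree_iff:
  "RDID_tree R T \<longleftrightarrow> is_tree T \<and> (\<forall>v\<in>verts T. v > 0) \<and>
     (\<forall>v\<in>verts T. vertex_ok R v (children T v) (descendants T v))"
proof -
  have "vertex_ok R v (children T v) (descendants T v)" if "is_tree T" "children T v = {}" for v
    using that descendants_decomp[of T v] by (simp add: vertex_ok_def)
  then have "(children T v \<noteq> {} \<longrightarrow> vertex_ok R v (children T v) (descendants T v)) \<longleftrightarrow>
      vertex_ok R v (children T v) (descendants T v)" if "is_tree T" for v
    using that by blast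
  then show ?thesis
    unfolding RDID_tree_def vertex_ok_def[symmetric] by (simp cong: conj_cong)
qed

lemma plane_subtree_props:
  assumes R: "\<forall>a\<in>R. odd a"
  shows "RDID_tree R T \<Longrightarrow> v \<in> verts T \<Longrightarrow>
    label (plane_subtree R T v) = v \<and> set (pw (plane_subtree R T v)) = insert v (descendants T v) \<and>
    distinct (pw (plane_subtree R T v)) \<and> rdid_plane R (plane_subtree R T v) \<and>
    parent_rel (plane_subtree R T v) = {(a, b). a \<in> insert v (descendants T v) \<and> b \<in> children T a}"
  using R
proof (induction R T v rule: plane_subtree.induct)
  case (1 R T v)
  have tree: "is_tree T" and ok: "vertex_ok R v (children T v) (descendants T v)"
    using 1 by (auto simp: RDID_tree_iff)
  note oc = set_ordered_children[OF tree "1.prems"(3) ok]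
  let ?p = "plane_subtree R T"
  have eq: "?p v = Node v (map ?p (ordered_children R T v))"
    using tree by (subst plane_subtree.simps) simp
  have IH: "label (?p c) = c" "set (pw (?p c)) = insert c (descendants T c)"
    "distinct (pw (?p c))" "rdid_plane R (?p c)"
    "parent_rel (?p c) = {(a, b). a \<in> insert c (descendants T c) \<and> b \<in> children T a}"
    if "c \<in> children T v" for c
  proof -
    have "c \<in> verts T" "c \<in> set (ordered_children R T v)"
      using that oc(1) children_iff[OF tree] by auto
    note IH = "1.IH"[OF tree this(2) "1.prems"(1) this(1) "1.prems"(3)]
    show "label (?p c) = c" "set (pw (?p c)) = insert c (descendants T c)"
      "distinct (pw (?p c))" "rdid_plane R (?p c)"
      "parent_rel (?p c) = {(a, b). a \<in> insert c (descendants T c) \<and> b \<in> children T a}"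
      by (insert IH; elim conjE; assumption)+
  qed
  have lab: "map label (map ?p (ordered_children R T v)) = ordered_children R T v"
    unfolding map_map by (rule map_idI) (use IH(1) oc(1) in simp)
  have set: "(\<Union>t\<in>set (map ?p (ordered_children R T v)). set (pw t)) = descendants T v"
    using IH(2) oc(1) descendants_decomp[OF tree, of v] by simp
  have "distinct (concat (map pw (map ?p (ordered_children R T v))))"
  proof -
    \<comment> \<open>A word ends in the root of its subtree, so different children have different
      words, as \<open>distinct_concat\<close> demands.\<close>
    have "c = c'" if "c \<in> children T v" "c' \<in> children T v" "pw (?p c) = pw (?p c')" for c c'
      using that IH(1) last_pw by metis
    then have "inj_on (\<lambda>c. pw (?p c)) (children T v)" by (auto intro: inj_onI)
    then have "distinct (map (\<lambda>c. pw (?p c)) (ordered_children R T v))"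
      using oc by (simp add: distinct_map)
    moreover have "set (pw (?p c)) \<inter> set (pw (?p c')) = {}"
      if "c \<in> children T v" "c' \<in> children T v" "pw (?p c) \<noteq> pw (?p c')" for c c'
      using that IH(2) children_descendants_disjoint[OF tree] by blast
    ultimately show ?thesis
      using IH(3) oc(1) by (intro distinct_concat) (auto simp: comp_def)
  qed
  moreover have "v \<notin> descendants T v" by (simp add: descendants_def)
  ultimately have "distinct (pw (?p v))" using set eq by auto
  moreover have "set (pw (?p v)) = insert v (descendants T v)" using set eq by simp
  moreover have "rdid_plane R (?p v)"
  proof -
    have "label ` set (map ?p (ordered_children R T v)) = children T v"
      using lab oc(1) by (metis list.set_map)
    then show ?thesis
      unfolding eq rdid_plane.simps set lab
      using ok IH(4) oc(1) ordered_children_eq[OF tree] by simp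
  qed
  moreover have "parent_rel (?p v) = {(a, b). a \<in> insert v (descendants T v) \<and> b \<in> children T a}"
  proof -
    have "parent_rel (?p v) = (\<Union>c\<in>children T v. insert (v, c)
        {(a, b). a \<in> insert c (descendants T c) \<and> b \<in> children T a})"
      using eq oc(1) IH(1,5) by simp
    also have "\<dots> = {(a, b). a \<in> insert v (descendants T v) \<and> b \<in> children T a}"
      by (subst descendants_decomp[OF tree, of v]) auto
    finally show ?thesis .
  qed
  ultimately show ?case using eq by simp
qed

text \<open>The equation for the edges recovers the graph from its plane tree; this gives the
  injectivity of \<open>hat\<close>.\<close>

lemma hat_props:
  assumes R: "\<forall>a\<in>R. odd a" and T: "RDID_tree R T"
  shows "label (hat R T) = Min (verts T)" "set (pw (hat R T)) = verts T" "distinct (pw (hat R T))"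
    "rdid_plane R (hat R T)" "edges T = (\<lambda>(a, b). {a, b}) ` parent_rel (hat R T)"
proof -
  have tree: "is_tree T" using T by (simp add: RDID_tree_iff)
  note p = plane_subtree_props[OF R T tree_root_in_verts[OF tree], folded verts_eq[OF tree] hat_def]
  show "label (hat R T) = Min (verts T)" using p by (simp add: tree_root_def)
  show "set (pw (hat R T)) = verts T" "distinct (pw (hat R T))" "rdid_plane R (hat R T)"
    using p by auto
  show "edges T = (\<lambda>(a, b). {a, b}) ` parent_rel (hat R T)"
  proof (intro equalityI subsetI)
    fix e assume e: "e \<in> edges T"
    then obtain u v where uv: "e = {u, v}" "adj T u v"
      using tree by (auto simp: is_tree_def simple_graph_def adj_def dest!: subsetD)
    then have "v \<in> children T u \<or> u \<in> children T v" "u \<in> verts T" "v \<in> verts T"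
      using adj_children[OF tree] adj_in_verts[OF tree] by auto
    then show "e \<in> (\<lambda>(a, b). {a, b}) ` parent_rel (hat R T)"
      using p uv by (force simp: insert_commute)
  next
    fix e assume "e \<in> (\<lambda>(a, b). {a, b}) ` parent_rel (hat R T)"
    then show "e \<in> edges T" using p by (auto simp: children_def adj_def)
  qed
qed

section \<open>From a plane tree back to a graph\<close>

lemma parent_rel_order: "(a, b) \<in> parent_rel t \<Longrightarrow> \<exists>xs ys zs. pw t = xs @ b # ys @ a # zs"
proof (induction t)
  case (Node v ts)
  then obtain t where t: "t \<in> set ts" "(a, b) = (v, label t) \<or> (a, b) \<in> parent_rel t" by auto
  obtain ps qs where pq: "ts = ps @ t # qs" using t(1) by (meson split_list)
  have pw: "pw (Node v ts) = concat (map pw ps) @ pw t @ concat (map pw qs) @ [v]"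
    using pq by simp
  show ?case
  proof (cases "(a, b) = (v, label t)")
    case True
    moreover have "pw t = butlast (pw t) @ [label t]"
      by (metis append_butlast_last_id last_pw pw_not_Nil)
    ultimately show ?thesis using pw by (metis append.assoc append_Cons append_Nil prod.inject)
  next
    case False
    then obtain xs ys zs where "pw t = xs @ b # ys @ a # zs" using Node.IH t by blast
    then have "pw (Node v ts) = (concat (map pw ps) @ xs) @ b # ys @ a # (zs @ concat (map pw qs) @ [v])"
      using pw by simp
    then show ?thesis by blast
  qed
qed

lemma parent_rel_in_pw: "(a, b) \<in> parent_rel t \<Longrightarrow> a \<in> set (pw t) \<and> b \<in> set (pw t)"
  using parent_rel_order by fastforce

text \<open>The rank of a letter is the length of the suffix of the postorder word that starts
  there; a parent comes after its child and has a shorter suffix.\<close>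

lemma parent_rel_ranked:
  assumes "distinct (pw t)"
  obtains k :: "nat \<Rightarrow> nat" where "\<And>a b. (a, b) \<in> parent_rel t \<Longrightarrow> k a < k b"
proof
  fix a b assume "(a, b) \<in> parent_rel t"
  then obtain xs ys zs where s: "pw t = xs @ b # ys @ a # zs" using parent_rel_order by blast
  have "dropWhile (\<lambda>y. y \<noteq> b) (pw t) = b # ys @ a # zs"
    using assms unfolding s by (subst dropWhile_append2) auto
  moreover have "dropWhile (\<lambda>y. y \<noteq> a) ((xs @ b # ys) @ a # zs) = a # zs"
    using assms unfolding s by (subst dropWhile_append2) auto
  ultimately show "length (dropWhile (\<lambda>y. y \<noteq> a) (pw t)) < length (dropWhile (\<lambda>y. y \<noteq> b) (pw t))"
    using s by simp
qed

text \<open>A child occurs before its parent, but the root is the last letter.\<close>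

lemma label_not_child:
  assumes "distinct (pw t)" shows "(a, label t) \<notin> parent_rel t"
proof
  assume "(a, label t) \<in> parent_rel t"
  then obtain xs ys zs where s: "pw t = xs @ label t # ys @ a # zs" using parent_rel_order by blast
  then have "label t = last (a # zs)"
    by (metis last_pw append_Cons append_is_Nil_conv last_appendR list.distinct(1))
  then have "label t \<in> set (a # zs)" by (metis last_in_set list.distinct(1))
  then show False using assms s by auto
qed

lemma pw_subtrees_disjoint:
  assumes "distinct (pw (Node v ts))" "s \<in> set ts" "t \<in> set ts" "x \<in> set (pw s)" "x \<in> set (pw t)"
  shows "s = t"
proof (rule ccontr)
  assume "s \<noteq> t"
  obtain ps qs where "ts = ps @ s # qs" using assms(2) by (meson split_list)
  moreover from this have "t \<in> set (ps @ qs)" using \<open>s \<noteq> t\<close> assms(3) by auto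
  ultimately show False using assms by auto
qed

lemma parent_rel_Image_subtree:
  assumes "distinct (pw (Node v ts))" "t \<in> set ts" "x \<in> set (pw t)"
  shows "parent_rel (Node v ts) `` {x} = parent_rel t `` {x}"
proof -
  have "x \<noteq> v" using assms by auto
  have "(x, y) \<in> parent_rel (Node v ts) \<longleftrightarrow> (x, y) \<in> parent_rel t" for y
  proof
    assume "(x, y) \<in> parent_rel (Node v ts)"
    then obtain s where s: "s \<in> set ts" "(x, y) \<in> parent_rel s" using \<open>x \<noteq> v\<close> by auto
    then have "x \<in> set (pw s)" using parent_rel_in_pw by blast
    then show "(x, y) \<in> parent_rel t"
      using pw_subtrees_disjoint[OF assms(1) s(1) assms(2) _ assms(3)] s(2) by blast
  qed (use assms(2) in auto)
  then show ?thesis by blast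
qed

lemma parent_unique:
  "distinct (pw t) \<Longrightarrow> (a, x) \<in> parent_rel t \<Longrightarrow> (b, x) \<in> parent_rel t \<Longrightarrow> a = b"
proof (induction t)
  case (Node v ts)
  obtain s t where st: "s \<in> set ts" "(a, x) = (v, label s) \<or> (a, x) \<in> parent_rel s"
    "t \<in> set ts" "(b, x) = (v, label t) \<or> (b, x) \<in> parent_rel t"
    using Node.prems by auto
  have "y \<in> set (pw u)" if "(c, y) = (v, label u) \<or> (c, y) \<in> parent_rel u" for c y u
    using that parent_rel_in_pw by auto
  then have "x \<in> set (pw s)" "x \<in> set (pw t)" using st by blast+
  then have "s = t" using pw_subtrees_disjoint Node.prems(1) st by blast
  moreover have "distinct (pw s)"
    using Node.prems(1) st(1) by (auto simp: distinct_concat_iff)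
  ultimately show ?case using st Node.IH label_not_child by auto
qed

lemma parent_rel_reaches: "x \<in> set (pw t) \<Longrightarrow> (label t, x) \<in> (parent_rel t)\<^sup>*"
proof (induction t)
  case (Node v ts)
  show ?case
  proof (cases "x = v")
    case False
    then obtain t where t: "t \<in> set ts" "x \<in> set (pw t)" using Node.prems by auto
    then have "(label t, x) \<in> (parent_rel (Node v ts))\<^sup>*"
      using Node.IH rtrancl_mono[of "parent_rel t" "parent_rel (Node v ts)"] by auto
    moreover have "(v, label t) \<in> parent_rel (Node v ts)" using t by auto
    ultimately show ?thesis by (metis converse_rtrancl_into_rtrancl label.simps)
  qed simp
qed

lemma adj_tree_graph: "adj (tree_graph t) a b \<longleftrightarrow> (a, b) \<in> parent_rel t \<or> (b, a) \<in> parent_rel t"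
  by (auto simp: adj_def tree_graph_def doubleton_eq_iff image_iff Bex_def)

lemma verts_tree_graph [simp]: "verts (tree_graph t) = set (pw t)"
  by (simp add: tree_graph_def)

text \<open>Whenever the walk returns to a visited vertex, the path is cut back to that
  vertex.\<close>

lemma graph_path_of_walk:
  assumes "(adj T)\<^sup>*\<^sup>* u v" "u \<in> verts T" "\<And>a b. adj T a b \<Longrightarrow> b \<in> verts T"
  shows "\<exists>p. graph_path T u p v"
  using assms(1)
proof induction
  case base
  show ?case using assms(2) by (intro exI[of _ "[u]"]) (simp add: graph_path_def)
next
  case (step y z)
  then obtain p where p: "graph_path T u p y" by blast
  show ?case
  proof (cases "z \<in> set p")
    case True
    then obtain as bs where "p = as @ z # bs" by (meson split_list)
    then show ?thesis using p graph_path_prefix by blast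
  next
    case False
    then have "graph_path T u (p @ [z]) z"
      using p step.hyps assms(3) by (auto simp: graph_path_def successively_append_iff)
    then show ?thesis by blast
  qed
qed

lemma is_tree_tree_graph:
  assumes dist: "distinct (pw t)"
  shows "is_tree (tree_graph t)"
proof -
  let ?T = "tree_graph t"
  obtain k :: "nat \<Rightarrow> nat" where k: "\<And>a b. (a, b) \<in> parent_rel t \<Longrightarrow> k a < k b"
    using parent_rel_ranked[OF dist] by blast
  have "a \<noteq> b" if "(a, b) \<in> parent_rel t" for a b
    using k[OF that] by auto
  then have "simple_graph ?T"
    unfolding simple_graph_def tree_graph_def using parent_rel_in_pw by fastforce
  moreover have "connected_graph ?T"
    unfolding connected_graph_def
  proof (intro conjI ballI)
    show "verts ?T \<noteq> {}" by simp
    fix u v assume u: "u \<in> verts ?T" and v: "v \<in> verts ?T"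
    have down: "(adj ?T)\<^sup>*\<^sup>* (label t) x" if "x \<in> set (pw t)" for x
      using parent_rel_reaches[OF that]
      by induction (auto simp: adj_tree_graph intro: rtranclp.rtrancl_into_rtrancl)
    have "symp (adj ?T)" using adj_sym by (metis sympI)
    then have "(adj ?T)\<^sup>*\<^sup>* u v"
      using down[of u] down[of v] u v by (metis rtranclp_trans symp_rtranclp sympD verts_tree_graph)
    then show "\<exists>p. graph_path ?T u p v"
      using u parent_rel_in_pw by (intro graph_path_of_walk) (auto simp: adj_tree_graph)
  qed
  moreover have "acyclic_graph ?T"
    unfolding acyclic_graph_def
  proof
    assume "\<exists>p. length p \<ge> 3 \<and> distinct p \<and> successively (adj ?T) p \<and> adj ?T (last p) (hd p)"
    then obtain p where p: "length p \<ge> 3" "distinct p" "successively (adj ?T) p"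
      "adj ?T (last p) (hd p)" by blast
    then have "p \<noteq> []" by auto
    txt \<open>Both neighbours on the cycle of a vertex of maximal rank are its parent.\<close>
    then have "Max (k ` set p) \<in> k ` set p" by (intro Max_in) auto
    then obtain x where x: "x \<in> set p" "k x = Max (k ` set p)" by auto
    have max: "k y \<le> k x" if "y \<in> set p" for y
      using that x(2) by simp
    obtain as bs where s: "p = as @ x # bs" using x(1) by (meson split_list)
    \<comment> \<open>The cycle read from just after \<open>x\<close>: its first and last entries
      are the two neighbours of \<open>x\<close>, also when \<open>x\<close> is an end of
      \<open>p\<close>.\<close>
    let ?r = "bs @ as"
    have "adj ?T x (hd ?r)" "adj ?T (last ?r) x"
      using p s by (cases as; cases bs; auto simp: successively_append_iff successively_Cons)+
    moreover have r: "length ?r \<ge> 2" "distinct ?r" using p s by auto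
    moreover have "?r \<noteq> []" using r by auto
    then have "hd ?r \<in> set p" "last ?r \<in> set p"
      using s hd_in_set[of ?r] last_in_set[of ?r] by auto
    then have "k (hd ?r) \<le> k x" "k (last ?r) \<le> k x" using max by blast+
    ultimately have "(hd ?r, x) \<in> parent_rel t" "(last ?r, x) \<in> parent_rel t"
      using k unfolding adj_tree_graph by (meson leD)+
    then have "hd ?r = last ?r" using parent_unique[OF dist] by blast
    moreover obtain a b cs where abcs: "?r = a # b # cs"
      using r(1) by (cases ?r; cases "tl ?r") auto
    ultimately have "a = last (b # cs)" by simp
    moreover have "distinct (a # b # cs)" using r(2) abcs by metis
    ultimately show False using last_in_set[of "b # cs"] by auto
  qed
  ultimately show ?thesis by (simp add: is_tree_def)
qed

text \<open>No vertex on a root path outranks its endpoint, whereas a child outranks its parent. So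
  a child is not on the path to its parent and extends it.\<close>

lemma children_tree_graph:
  assumes dist: "distinct (pw t)" and root: "label t = Min (set (pw t))"
    and x: "x \<in> set (pw t)"
  shows "children (tree_graph t) x = parent_rel t `` {x}"
proof -
  let ?T = "tree_graph t"
  note tree = is_tree_tree_graph[OF dist]
  have rt: "tree_root ?T = label t" using root by (simp add: tree_root_def)
  obtain k :: "nat \<Rightarrow> nat" where k: "\<And>a b. (a, b) \<in> parent_rel t \<Longrightarrow> k a < k b"
    using parent_rel_ranked[OF dist] by blast
  have snoc: "root_path ?T c = root_path ?T a @ [c]"
    if "\<forall>y\<in>set (root_path ?T a). k y \<le> k a" "(a, c) \<in> parent_rel t" for a c
    using that k[of a c] by (intro root_path_snoc[OF tree]) (auto simp: adj_tree_graph)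
  have rank: "\<forall>y\<in>set (root_path ?T a). k y \<le> k a" if "a \<in> set (pw t)" for a
    using parent_rel_reaches[OF that]
  proof induction
    case base
    then show ?case using root_path_root[OF tree] rt by simp
  next
    case (step b c)
    then show ?case using snoc[OF step.IH step.hyps(2)] k[OF step.hyps(2)] by fastforce
  qed
  have child: "c \<in> children ?T a" if "(a, c) \<in> parent_rel t" for a c
    using snoc[OF rank that] parent_rel_in_pw[OF that] children_iff[OF tree] by simp
  show ?thesis
  proof (intro equalityI subsetI)
    fix c assume c: "c \<in> children ?T x"
    then have "(c, x) \<notin> parent_rel t" using child children_asym[OF tree] by blast
    then show "c \<in> parent_rel t `` {x}" using c by (auto simp: children_def adj_tree_graph)
  qed (use child in blast)
qed

text \<open>Stated for a part \<open>s\<close> of the plane tree with the whole graph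
  \<open>T\<close> fixed, so that the induction can descend into subtrees.\<close>

lemma plane_subtree_of_children:
  assumes tree: "is_tree T"
  shows "\<lbrakk>distinct (pw s); rdid_plane R s; \<forall>x\<in>set (pw s). children T x = parent_rel s `` {x}\<rbrakk> \<Longrightarrow>
    plane_subtree R T (label s) = s \<and> set (pw s) = insert (label s) (descendants T (label s)) \<and>
    (\<forall>x\<in>set (pw s). vertex_ok R x (children T x) (descendants T x))"
proof (induction s)
  case (Node v ts)
  have IH: "plane_subtree R T (label t) = t" "set (pw t) = insert (label t) (descendants T (label t))"
    "\<forall>x\<in>set (pw t). vertex_ok R x (children T x) (descendants T x)" if t: "t \<in> set ts" for t
  proof -
    have "children T x = parent_rel t `` {x}" if x: "x \<in> set (pw t)" for x
      using parent_rel_Image_subtree[OF Node.prems(1) t x] Node.prems(3) t x by auto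
    moreover have "distinct (pw t)" "rdid_plane R t"
      using Node.prems t by (auto simp: distinct_concat_iff)
    ultimately show "plane_subtree R T (label t) = t"
      "set (pw t) = insert (label t) (descendants T (label t))"
      "\<forall>x\<in>set (pw t). vertex_ok R x (children T x) (descendants T x)"
      using Node.IH[OF t] by blast+
  qed
  have "parent_rel (Node v ts) `` {v} = label ` set ts"
    using Node.prems(1) parent_rel_in_pw by fastforce
  then have ch: "children T v = label ` set ts" using Node.prems(3) by simp
  have desc: "descendants T v = (\<Union>t\<in>set ts. set (pw t))"
    using descendants_decomp[OF tree, of v] ch IH(2) by simp
  have "map (plane_subtree R T) (map label ts) = ts"
    using IH(1) by (simp add: map_idI)
  moreover have "ordered_children R T v = map label ts"
    using Node.prems(2) ch ordered_children_eq[OF tree] by simp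
  ultimately have "plane_subtree R T v = Node v ts"
    using tree by (subst plane_subtree.simps) simp
  moreover have "vertex_ok R v (children T v) (descendants T v)"
    using Node.prems(2) ch desc by simp
  ultimately show ?case using desc IH(3) by auto
qed

text \<open>Preimages are supplied by \<open>tree_graph\<close>.\<close>

lemma bij_betw_hat:
  assumes R: "\<forall>a\<in>R. odd a" and pos: "\<forall>a\<in>A. a > 0"
  shows "bij_betw (hat R) (RDID_trees R A)
    {t. rdid_plane R t \<and> distinct (pw t) \<and> set (pw t) = A \<and> label t = Min A}"
  unfolding bij_betw_def
proof (intro conjI equalityI subsetI)
  show "inj_on (hat R) (RDID_trees R A)"
  proof (rule inj_onI)
    fix T T' assume T: "T \<in> RDID_trees R A" "T' \<in> RDID_trees R A" "hat R T = hat R T'"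
    then have "verts T = verts T'" "edges T = edges T'"
      using hat_props(5)[OF R] by (auto simp: RDID_trees_def)
    then show "T = T'" by simp
  qed
next
  fix t assume "t \<in> hat R ` RDID_trees R A"
  then show "t \<in> {t. rdid_plane R t \<and> distinct (pw t) \<and> set (pw t) = A \<and> label t = Min A}"
    using hat_props[OF R] by (auto simp: RDID_trees_def)
next
  fix t assume "t \<in> {t. rdid_plane R t \<and> distinct (pw t) \<and> set (pw t) = A \<and> label t = Min A}"
  then have t: "rdid_plane R t" "distinct (pw t)" "set (pw t) = A" "label t = Min (set (pw t))" by auto
  let ?T = "tree_graph t"
  note tree = is_tree_tree_graph[OF t(2)]
  note p = plane_subtree_of_children[OF tree t(2,1)]
  have ch: "\<forall>x\<in>set (pw t). children ?T x = parent_rel t `` {x}"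
    using children_tree_graph[OF t(2,4)] by blast
  have "RDID_tree R ?T" using p[OF ch] tree pos t(3) by (simp add: RDID_tree_iff)
  then have "?T \<in> RDID_trees R A" using t(3) by (simp add: RDID_trees_def)
  moreover have "hat R ?T = t" using p[OF ch] t(4) by (simp add: hat_def tree_root_def)
  ultimately show "t \<in> hat R ` RDID_trees R A" by (metis image_eqI)
qed

section \<open>Words and cycles\<close>

lemma cycle_of_list_nth:
  assumes "distinct w" "i < length w"
  shows "cycle_of_list w (w ! i) = w ! (Suc i mod length w)"
proof -
  have "map (cycle_of_list w) w = rotate1 w"
    using cyclic_rotation[OF assms(1), of 1] by simp
  then have "cycle_of_list w (w ! i) = rotate1 w ! i"
    using assms(2) by (metis nth_map)
  then show ?thesis using assms(2) by (simp add: nth_rotate1)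
qed

text \<open>The last letter wraps around to position 0, hence the exponent \<open>Suc i\<close>.
  Thus a cycle and the last letter determine the word.\<close>

lemma funpow_cycle_of_list_last:
  assumes "distinct w" "i < length w"
  shows "(cycle_of_list w ^^ Suc i) (last w) = w ! i"
  using assms(2)
proof (induction i)
  case 0
  then have "last w = w ! (length w - 1)" by (simp add: last_conv_nth)
  then show ?case using cycle_of_list_nth[OF assms(1), of "length w - 1"] 0 by simp
next
  case (Suc i)
  then show ?case using cycle_of_list_nth[OF assms(1), of i] by simp
qed

lemma cyclic_on_cycle_of_list:
  assumes "distinct w" "w \<noteq> []"
  shows "cyclic_on (cycle_of_list w) (set w)"
proof (rule cyclic_on_singleI)
  show "last w \<in> set w" using assms by simp
  show "set w = orbit (cycle_of_list w) (last w)"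
  proof
    show "set w \<subseteq> orbit (cycle_of_list w) (last w)"
    proof
      fix x assume "x \<in> set w"
      then obtain i where "i < length w" "x = w ! i" by (auto simp: in_set_conv_nth)
      then have "x = (cycle_of_list w ^^ Suc i) (last w)"
        using funpow_cycle_of_list_last[OF assms(1)] by metis
      then show "x \<in> orbit (cycle_of_list w) (last w)"
        unfolding orbit_altdef by blast
    qed
    show "orbit (cycle_of_list w) (last w) \<subseteq> set w"
      by (rule permutes_orbit_subset[OF cycle_permutes]) (use assms in simp)
  qed
qed

lemma cyclic_on_word:
  assumes perm: "\<sigma> permutes A" and cyc: "cyclic_on \<sigma> A" and r: "r \<in> A"
  obtains w where "distinct w" "set w = A" "last w = r" "cycle_of_list w = \<sigma>"
proof -
  have A: "A = orbit \<sigma> r" using orbit_cyclic_eq3[OF cyc r] by simp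
  \<comment> \<open>\<open>n\<close> is the first return time of \<open>r\<close>, that is, the
    length of the cycle.\<close>
  define n where "n = funpow_dist1 \<sigma> r r"
  have r': "r \<in> orbit \<sigma> r" using A r by simp
  have fixed: "(\<sigma> ^^ n) r = r" unfolding n_def using funpow_dist1_prop[OF r'] .
  have n: "n > 0" by (simp add: n_def)
  have inj: "inj_on (\<lambda>i. (\<sigma> ^^ i) r) {0..<n}" unfolding n_def using inj_on_funpow_dist1[OF r'] .
  \<comment> \<open>The exponent 0 comes last, so that the word ends in \<open>r\<close>.\<close>
  define w where "w = map (\<lambda>i. (\<sigma> ^^ i) r) ([1..<n] @ [0])"
  have len: "length w = n" using n by (simp add: w_def)
  have idx: "set ([1..<n] @ [0]) = {0..<n}" using n by auto
  have dist: "distinct w" unfolding w_def distinct_map idx using inj by simp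
  have "set w = (\<lambda>i. (\<sigma> ^^ i) r) ` {0..<n}" unfolding w_def set_map idx ..
  then have set: "set w = A" unfolding A n_def using orbit_conv_funpow_dist1[OF r'] by simp
  have nth: "w ! i = (\<sigma> ^^ Suc i) r" if "i < n" for i
  proof (cases "i = n - 1")
    case True
    then show ?thesis using fixed n that by (simp add: w_def nth_append del: funpow.simps)
  next
    case False
    then have "i < n - 1" using that by linarith
    then show ?thesis by (simp add: w_def nth_append del: funpow.simps)
  qed
  have "cycle_of_list w x = \<sigma> x" for x
  proof (cases "x \<in> set w")
    case True
    then obtain i where i: "i < n" "x = w ! i" by (auto simp: in_set_conv_nth len)
    show ?thesis
    proof (cases "Suc i = n")
      case True
      then show ?thesis
        using cycle_of_list_nth[OF dist, of i] i nth[of i] nth[of 0] n fixed len by simp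
    next
      case False
      then show ?thesis
        using cycle_of_list_nth[OF dist, of i] i nth[of i] nth[of "Suc i"] len by simp
    qed
  next
    case False
    then show ?thesis using id_outside_supp[of x w] permutes_not_in[OF perm] set by simp
  qed
  then show thesis using dist set by (intro that[of w]) (auto simp: w_def)
qed

lemma successively_iff_cycle:
  assumes "distinct w" "w \<noteq> []"
  shows "successively P w \<longleftrightarrow> (\<forall>i\<in>set w. i \<noteq> last w \<longrightarrow> P i (cycle_of_list w i))"
proof -
  have "successively P w \<longleftrightarrow> (\<forall>i. Suc i < length w \<longrightarrow> P (w ! i) (cycle_of_list w (w ! i)))"
    using cycle_of_list_nth[OF assms(1)] by (simp add: successively_conv_nth)
  also have "\<dots> \<longleftrightarrow> (\<forall>i<length w. w ! i \<noteq> last w \<longrightarrow> P (w ! i) (cycle_of_list w (w ! i)))"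
  proof -
    have "w ! i \<noteq> last w \<longleftrightarrow> Suc i < length w" if "i < length w" for i
      using that assms nth_eq_iff_index_eq[OF assms(1), of i "length w - 1"]
      by (auto simp: last_conv_nth)
    then show ?thesis by (metis Suc_lessD)
  qed
  finally show ?thesis by (metis in_set_conv_nth)
qed

lemma cycle_of_list_neq:
  assumes "distinct w" "length w \<noteq> 1" "x \<in> set w"
  shows "cycle_of_list w x \<noteq> x"
proof
  assume eq: "cycle_of_list w x = x"
  obtain i where i: "i < length w" "x = w ! i" using assms(3) by (auto simp: in_set_conv_nth)
  then have "w ! (Suc i mod length w) = w ! i" using cycle_of_list_nth[OF assms(1)] eq by metis
  moreover have "Suc i mod length w < length w" by (rule mod_less_divisor) (use i(1) in linarith)
  ultimately have "Suc i mod length w = i" using nth_eq_iff_index_eq[OF assms(1) _ i(1)] by blast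
  then show False using i(1) assms(2) by (cases "Suc i = length w") auto
qed

text \<open>Without fixed points the condition is \<open>step_ok\<close> at every letter. The steps
  inside the word give \<open>successively\<close>; the step from the last letter, the minimum, goes
  up and is allowed exactly if the minimum is odd. A single letter is a fixed point and always
  allowed.\<close>

lemma RD_permutation_cycle_of_list:
  assumes w: "distinct w" "w \<noteq> []" "last w = Min (set w)"
  shows "RD_permutation R (set w) (cycle_of_list w) \<longleftrightarrow>
    successively (step_ok R) w \<and> (even (last w) \<longrightarrow> length w = 1)"
proof (cases "length w = 1")
  case True
  then obtain x where "w = [x]" by (auto simp: length_Suc_conv)
  then show ?thesis using cycle_permutes[of w] by (auto simp: RD_permutation_def)
next
  case False
  let ?\<sigma> = "cycle_of_list w"
  have neq: "?\<sigma> i \<noteq> i" if "i \<in> set w" for i using cycle_of_list_neq[OF w(1) False that] .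
  have last: "last w < ?\<sigma> (last w)"
  proof -
    have "last w \<in> set w" using w(2) by simp
    then have "?\<sigma> (last w) \<in> set w" by (simp only: permutes_in_image[OF cycle_permutes])
    then have "Min (set w) \<le> ?\<sigma> (last w)" by (rule Min_le[OF finite_set])
    then show ?thesis using w(3) neq[OF \<open>last w \<in> set w\<close>] by linarith
  qed
  have "RD_permutation R (set w) ?\<sigma> \<longleftrightarrow> (\<forall>i\<in>set w. step_ok R i (?\<sigma> i))"
  proof -
    have "(odd i \<and> i \<notin> R \<longrightarrow> i \<le> ?\<sigma> i) \<and> (even i \<longrightarrow> ?\<sigma> i \<le> i) \<longleftrightarrow> step_ok R i (?\<sigma> i)"
      if "i \<in> set w" for i
      using neq[OF that] unfolding step_ok_def by linarith
    then show ?thesis using cycle_permutes[of w] by (simp add: RD_permutation_def)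
  qed
  also have "\<dots> \<longleftrightarrow> successively (step_ok R) w \<and> step_ok R (last w) (?\<sigma> (last w))"
    using w unfolding successively_iff_cycle[OF w(1,2)] by auto
  also have "step_ok R (last w) (?\<sigma> (last w)) \<longleftrightarrow> odd (last w)"
    using last by (auto simp: step_ok_def)
  finally show ?thesis using False by simp
qed

lemma bij_betw_cycle_of_list:
  assumes A: "finite A" "A \<noteq> {}"
  shows "bij_betw cycle_of_list
    {w. distinct w \<and> set w = A \<and> last w = Min A \<and> successively (step_ok R) w \<and>
      (even (last w) \<longrightarrow> length w = 1)} (RD_cycles R A)"
    (is "bij_betw _ ?W _")
  unfolding bij_betw_def
proof (intro conjI equalityI subsetI)
  show "inj_on cycle_of_list ?W"
  proof (rule inj_onI)
    fix w w' assume w: "w \<in> ?W" "w' \<in> ?W" "cycle_of_list w = cycle_of_list w'"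
    then have len: "length w = length w'" using distinct_card[of w] distinct_card[of w'] by simp
    have "w ! i = w' ! i" if "i < length w" for i
      using funpow_cycle_of_list_last[of w i] funpow_cycle_of_list_last[of w' i] w len that
      by (simp del: funpow.simps)
    then show "w = w'" using len by (simp add: nth_equalityI)
  qed
next
  fix \<sigma> assume "\<sigma> \<in> cycle_of_list ` ?W"
  then obtain w where w: "w \<in> ?W" "\<sigma> = cycle_of_list w" by blast
  then have "w \<noteq> []" using A by auto
  then show "\<sigma> \<in> RD_cycles R A"
    using w RD_permutation_cycle_of_list[of w R] cyclic_on_cycle_of_list[of w]
    by (auto simp: RD_cycles_def)
next
  fix \<sigma> assume \<sigma>: "\<sigma> \<in> RD_cycles R A"
  obtain w where w: "distinct w" "set w = A" "last w = Min A" "cycle_of_list w = \<sigma>"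
    using cyclic_on_word[of \<sigma> A "Min A"] \<sigma> A by (auto simp: RD_cycles_def RD_permutation_def)
  then have "w \<noteq> []" using A by auto
  then have "w \<in> ?W" using w \<sigma> RD_permutation_cycle_of_list[of w R] by (auto simp: RD_cycles_def)
  then show "\<sigma> \<in> cycle_of_list ` ?W" using w(4) by blast
qed

section \<open>Postorder as a bijection and the composite map\<close>

lemma bij_betw_pw:
  assumes R: "\<forall>a\<in>R. odd a" and down: "\<forall>a\<in>R. \<forall>b\<in>A. odd b \<and> b \<le> a \<longrightarrow> b \<in> R"
    and sub: "R \<subseteq> A" and A: "finite A" "A \<noteq> {}"
  shows "bij_betw pw {t. rdid_plane R t \<and> distinct (pw t) \<and> set (pw t) = A \<and> label t = Min A}
    {w. distinct w \<and> set w = A \<and> last w = Min A \<and> successively (step_ok R) w \<and>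
      (even (last w) \<longrightarrow> length w = 1)}"
    (is "bij_betw _ ?P ?W")
  unfolding bij_betw_def
proof (intro conjI equalityI subsetI)
  show "inj_on pw ?P" using pw_injective[OF R] by (auto intro: inj_onI)
next
  fix w assume "w \<in> pw ` ?P"
  then obtain t where t: "rdid_plane R t" "distinct (pw t)" "set (pw t) = A" "label t = Min A"
    and w: "w = pw t" by blast
  \<comment> \<open>An even root is the maximum of the tree and here also the minimum of
    \<open>A\<close>, so \<open>A\<close> is a singleton.\<close>
  have "length w = 1" if "even (last w)"
  proof -
    have "y = Min A" if "y \<in> A" for y
      using rdid_plane_extremal(1)[OF t(1), of y] t \<open>even (last w)\<close> w that
        Min_le[OF A(1) that] by (simp add: antisym)
    then have "A = {Min A}" using A Min_in by blast
    then show ?thesis using distinct_card[OF t(2)] t(3) w by (metis card_1_singleton_iff One_nat_def)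
  qed
  then show "w \<in> ?W" using t w successively_pw[OF R t(1,2)] by simp
next
  fix w assume w: "w \<in> ?W"
  then have ne: "w \<noteq> []" using A by auto
  have "last w = Min A" using w by simp
  \<comment> \<open>If the minimum is odd, it lies below every element of \<open>R\<close>; being
    outside the initial segment \<open>R\<close>, it forces \<open>R\<close> to be empty.\<close>
  have "set w \<inter> R = {}" if "last w \<notin> R"
  proof (cases "even (last w)")
    case True
    then have "set w = {last w}" using w by (auto simp: length_Suc_conv)
    then show ?thesis using that by simp
  next
    case False
    have "last w \<le> a" if "a \<in> R" for a using w that sub A by auto
    moreover have "last w \<in> A" using w ne last_in_set by blast
    ultimately have "R = {}" using False that down by blast
    then show ?thesis by simp
  qed
  moreover have "\<forall>y\<in>set w. y \<le> last w" if "even (last w)"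
    using w that by (auto simp: length_Suc_conv)
  ultimately have "plane_word R w" using w ne down A by (auto simp: plane_word_def)
  then obtain t where "rdid_plane R t" "pw t = w" using plane_tree_exists[OF R] by blast
  moreover from this have "label t = last w" by auto
  ultimately show "w \<in> pw ` ?P" using w by auto
qed

theorem theorem4p6:
  fixes A R :: "nat set" and m :: nat
  assumes "finite A" and "A \<noteq> {}" and "\<forall>a\<in>A. a > 0"
    and "m \<ge> 1" and "odd m"
    and "R = {i \<in> {1..m}. odd i} \<inter> A"
  shows "(\<forall>T\<in>RDID_trees R A. distinct (pw (hat R T)) \<and> set (pw (hat R T)) = A \<and>
            psi R T \<in> RD_cycles R A)
       \<and> bij_betw (psi R) (RDID_trees R A) (RD_cycles R A)
       \<and> card (RDID_trees R A) = card (RD_cycles R A)"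
proof -
  have R: "\<forall>a\<in>R. odd a" and down: "\<forall>a\<in>R. \<forall>b\<in>A. odd b \<and> b \<le> a \<longrightarrow> b \<in> R" and sub: "R \<subseteq> A"
    using assms(3,6) by (auto simp: Suc_le_eq)
  \<comment> \<open>The map factors through plane trees and words ending in \<open>Min A\<close>,
    and each factor is a bijection.\<close>
  have "psi R = cycle_of_list \<circ> (pw \<circ> hat R)" by (auto simp: psi_def)
  then have bij: "bij_betw (psi R) (RDID_trees R A) (RD_cycles R A)"
    using bij_betw_trans[OF bij_betw_trans[OF bij_betw_hat[OF R assms(3)]
          bij_betw_pw[OF R down sub assms(1,2)]] bij_betw_cycle_of_list[OF assms(1,2)]]
    by simp
  then have "psi R T \<in> RD_cycles R A" if "T \<in> RDID_trees R A" for T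
    using that by (rule bij_betw_apply)
  moreover have "distinct (pw (hat R T)) \<and> set (pw (hat R T)) = A" if "T \<in> RDID_trees R A" for T
    using that hat_props(2,3)[OF R] by (auto simp: RDID_trees_def)
  ultimately show ?thesis using bij bij_betw_same_card by blast
qed

end
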